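(* Let $\Omega=\mathbb{R}^n$, $p\ge1$, let $f$ satisfy the standing assumptions and in addition $f\in C^2((0,+\infty))$, with $k=(f')^{-1}$, and let $g:[0,1]\to[0,+\infty)$ be subadditive, lower semicontinuous, with $g(0)=0$, $\lim_{t\to0^+}g(t)/t=+\infty$, and $g\in C^2((0,1])\cap C^0([0,1])$. Suppose that $$\limsup_{R\to0^+}\ g''\!\left(\int_0^R k(R^p-r^p)\,n\omega_n r^{n-1}\,dr\right)\int_0^R k'(R^p-r^p)\,n\omega_n r^{n-1}\,dr<-1,$$ where $\omega_n$ is the volume of the unit ball in $\mathbb{R}^n$. Then the minimization problem for $\mathfrak{F}^p$ over $\mathcal{W}_p(\mathbb{R}^n)\times\mathcal{W}_p(\mathbb{R}^n)$ has a solution.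
   Context: Standing assumptions on $f$: $f:[0,+\infty)\to[0,+\infty)$ is strictly convex and $C^1$, $f(0)=0$, $f'(0)=0$, and $\lim_{t\to+\infty}f(t)/t=+\infty$; $k=(f')^{-1}:[0,+\infty)\to[0,+\infty)$, and $k'$ denotes its derivative on $(0,+\infty)$. $\mathcal{W}_p(\mathbb{R}^n)=\{\lambda\in\mathcal{P}(\mathbb{R}^n):\int|x|^p\,d\lambda<+\infty\}$. $T_p(\mu,\nu)=\inf_\gamma\int|x-y|^p\,d\gamma$ over transport plans. $F(\mu)=\int f(u)\,dx$ if $\mu=u\cdot\mathcal{L}^n$, $+\infty$ otherwise. $G(\nu)=\sum_i g(a_i)$ if $\nu=\sum_{i}a_i\delta_{x_i}$ is purely atomic (distinct $x_i$), $+\infty$ otherwise. $\mathfrak{F}^p(\mu,\nu)=T_p(\mu,\nu)+F(\mu)+G(\nu)$. *)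

theory Defs
  imports "HOL-Analysis.Analysis" "HOL-Probability.Probability"
begin

definition strictly_convex_on :: "real set \<Rightarrow> (real \<Rightarrow> real) \<Rightarrow> bool" where
  "strictly_convex_on S h \<longleftrightarrow>
     (\<forall>x\<in>S. \<forall>y\<in>S. x \<noteq> y \<longrightarrow> (\<forall>t. 0 < t \<and> t < 1 \<longrightarrow>
        h ((1 - t) * x + t * y) < (1 - t) * h x + t * h y))"

definition lsc_on :: "real set \<Rightarrow> (real \<Rightarrow> real) \<Rightarrow> bool" where
  "lsc_on S h \<longleftrightarrow>
     (\<forall>x\<in>S. \<forall>c. c < h x \<longrightarrow> (\<exists>e>0. \<forall>y\<in>S. \<bar>y - x\<bar> < e \<longrightarrow> c < h y))"

definition Wp :: "real \<Rightarrow> 'a::euclidean_space measure set" where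
  "Wp p = {\<mu>. prob_space \<mu> \<and> sets \<mu> = sets borel \<and>
              (\<integral>\<^sup>+ x. ennreal (norm x powr p) \<partial>\<mu>) < \<infinity>}"

definition plans :: "'a::euclidean_space measure \<Rightarrow> 'a measure \<Rightarrow> ('a \<times> 'a) measure set" where
  "plans \<mu> \<nu> = {\<gamma>. prob_space \<gamma> \<and> sets \<gamma> = sets (borel \<Otimes>\<^sub>M borel) \<and>
                   distr \<gamma> borel fst = \<mu> \<and> distr \<gamma> borel snd = \<nu>}"

definition Tp :: "real \<Rightarrow> 'a::euclidean_space measure \<Rightarrow> 'a measure \<Rightarrow> ennreal" where
  "Tp p \<mu> \<nu> = (INF \<gamma>\<in>plans \<mu> \<nu>. \<integral>\<^sup>+ z. ennreal (norm (fst z - snd z) powr p) \<partial>\<gamma>)"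

definition Fen :: "(real \<Rightarrow> real) \<Rightarrow> 'a::euclidean_space measure \<Rightarrow> ennreal" where
  "Fen f \<mu> =
     (if \<exists>u. u \<in> borel_measurable lborel \<and> (\<forall>x. 0 \<le> u x) \<and> \<mu> = density lborel (\<lambda>x. ennreal (u x))
      then \<integral>\<^sup>+ x. ennreal (f ((SOME u. u \<in> borel_measurable lborel \<and> (\<forall>x. 0 \<le> u x) \<and>
                                   \<mu> = density lborel (\<lambda>x. ennreal (u x))) x)) \<partial>lborel
      else \<infinity>)"

definition Gen :: "(real \<Rightarrow> real) \<Rightarrow> 'a::euclidean_space measure \<Rightarrow> ennreal" where
  "Gen g \<nu> =
     (if \<exists>S. countable S \<and> emeasure \<nu> (space \<nu> - S) = 0
      then \<integral>\<^sup>+ x. ennreal (g (measure \<nu> {x})) \<partial>count_space {x. measure \<nu> {x} \<noteq> 0}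
      else \<infinity>)"

definition Fp :: "real \<Rightarrow> (real \<Rightarrow> real) \<Rightarrow> (real \<Rightarrow> real) \<Rightarrow> 'a::euclidean_space measure \<Rightarrow> 'a measure \<Rightarrow> ennreal" where
  "Fp p f g \<mu> \<nu> = Tp p \<mu> \<nu> + Fen f \<mu> + Gen g \<nu>"

end

theory Submission
  imports Defs
begin

text \<open>
  In \<open>\<real>\<^sup>n\<close> atoms can be placed so far apart that they do not interact, so the problem is
  equivalent to minimising \<open>\<Sum>i. E a\<^sub>i + g a\<^sub>i\<close> over sequences of masses with sum 1, where
  \<open>E m\<close> is the least transport and congestion cost of a mass \<open>m\<close> served by one atom. By convex
  duality \<open>E m = max\<^sub>c (c m - Phi c)\<close> with optimal density \<open>k ((c - |y|\<^sup>p)\<^sup>+)\<close>; hence \<open>E' m\<close> is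
  the multiplier \<open>c = R\<^sup>p\<close> and \<open>E'' m\<close> is the reciprocal of the integral of \<open>k'\<close> in the
  hypothesis, which therefore says that \<open>E + g\<close> is strictly concave near 0. So \<open>E + g\<close> is
  subadditive near 0, small masses can be merged, and the minimum is taken over at most \<open>N\<close>
  masses, where it is attained by compactness.
\<close>

text \<open>\<open>E''\<close> is never formed. \<open>M c\<close>, the mass that the multiplier
  \<open>c\<close> produces, is known only as an integral of the extended-valued \<open>A\<close>,
  which is shown neither finite nor continuous, so neither \<open>M\<close> nor its inverse
  \<open>C\<close> can be differentiated outright. Concavity is therefore stated as monotonicity of
  \<open>C m + g' m\<close>, obtained from a lower bound on \<open>A\<close>; continuity of
  \<open>C\<close>, and with it differentiability of \<open>E\<close>, is then read off from that
  monotonicity.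

  Minimising sequences of measures need not be tight, since moving an atom together with the mass it
  serves costs nothing. No limit of measures is taken: every competitor is bounded below by duality
  on finitely many of its atoms, and the mass of the others is put into one fictitious atom, whose
  cost is small because \<open>E + g\<close> is continuous at 0 with value 0.\<close>

lemma strictly_convex_on_imp_convex_on:
  assumes "strictly_convex_on S h" "convex S"
  shows "convex_on S h"
proof (rule convex_onI)
  fix t x y :: real
  assume *: "0 < t" "t < 1" "x \<in> S" "y \<in> S"
  show "h ((1 - t) *\<^sub>R x + t *\<^sub>R y) \<le> (1 - t) * h x + t * h y"
  proof (cases "x = y")
    case True
    then show ?thesis by (simp add: algebra_simps)
  next
    case False
    then show ?thesis using assms(1) * unfolding strictly_convex_on_def by (auto intro: less_imp_le)
  qed
qed (fact assms(2))

section \<open>The conjugate of the congestion function\<close>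

locale congestion =
  fixes f f' k k' :: "real \<Rightarrow> real"
  assumes f_nonneg: "t \<ge> 0 \<Longrightarrow> 0 \<le> f t"
    and f_conv: "strictly_convex_on {0..} f"
    and f_deriv: "t \<ge> 0 \<Longrightarrow> (f has_real_derivative f' t) (at t within {0..})"
    and f_0: "f 0 = 0" and f'_0: "f' 0 = 0"
    and k_nonneg: "s \<ge> 0 \<Longrightarrow> 0 \<le> k s" and f'_k: "s \<ge> 0 \<Longrightarrow> f' (k s) = s"
    and k_deriv: "s > 0 \<Longrightarrow> (k has_real_derivative k' s) (at s)"
begin

lemma f_tangent:
  assumes "t > 0" "u \<ge> 0"
  shows "f t + f' t * (u - t) \<le> f u"
proof -
  have "f u - f t \<ge> f' t * (u - t)"
  proof (rule convex_on_imp_above_tangent[where A = "{0..}"])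
    show "convex_on {0..} f"
      by (rule strictly_convex_on_imp_convex_on[OF f_conv]) simp
  qed (use assms f_deriv in auto)
  then show ?thesis by simp
qed

lemma f_pos: assumes "t > 0" shows "f t > 0"
proof -
  have "f ((1 - 1/2) * 0 + 1/2 * t) < (1 - 1/2) * f 0 + 1/2 * f t"
    using f_conv[unfolded strictly_convex_on_def, rule_format, of 0 t "1/2"] assms by simp
  then show ?thesis using f_nonneg[of "t / 2"] f_0 assms by auto
qed

lemma f'_pos: assumes "t > 0" shows "f' t > 0"
proof -
  have "f t \<le> f' t * t" using f_tangent[OF assms, of 0] f_0 by (simp add: algebra_simps)
  then have "0 < f' t * t" using f_pos[OF assms] by linarith
  then show ?thesis using assms by (simp add: zero_less_mult_iff)
qed

text \<open>Adding the tangent inequalities at \<open>a\<close> and \<open>b\<close> cancels the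
  values of \<open>f\<close>. They are available only at positive points, so \<open>a = 0\<close> is
  settled by the sign of \<open>f'\<close>.\<close>

lemma f'_mono: assumes "0 \<le> a" "a \<le> b" shows "f' a \<le> f' b"
proof (cases "a = 0 \<or> a = b")
  case True
  then show ?thesis using f'_0 f'_pos[of b] assms by (cases "b = 0") auto
next
  case False
  then have "f a + f' a * (b - a) \<le> f b" "f b + f' b * (a - b) \<le> f a"
    using f_tangent assms by auto
  then have "f' a * (b - a) \<le> f' b * (b - a)" by (simp add: algebra_simps)
  then show ?thesis using False assms by simp
qed

lemma k_0: "k 0 = 0"
  using f'_pos[of "k 0"] f'_k[of 0] k_nonneg[of 0] by force

lemma k_less: assumes "0 \<le> s" "s < s'" shows "k s < k s'"
  using f'_mono[of "k s'" "k s"] f'_k[of s] f'_k[of s'] k_nonneg[of s'] assms by force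

lemma k_pos: "s > 0 \<Longrightarrow> k s > 0"
  using k_less[of 0 s] k_0 by simp

text \<open>At \<open>s = f' t + 1\<close> the value \<open>k s\<close> must exceed
  \<open>t\<close>: otherwise monotonicity would give \<open>f' t + 1 \<le> f' t\<close>.\<close>

lemma k_unbounded: assumes "t \<ge> 0" obtains s where "s \<ge> 0" "k s > t"
proof
  show *: "f' t + 1 \<ge> 0" using f'_mono[of 0 t] f'_0 assms by simp
  show "k (f' t + 1) > t"
    using f'_mono[of "k (f' t + 1)" t] f'_k[OF *] k_nonneg[OF *] by force
qed

text \<open>Extending \<open>k\<close> by 0 builds the positive part of \<open>c - w y\<close> into
  the density, which then vanishes by itself outside a ball.\<close>

definition kp :: "real \<Rightarrow> real" where "kp s = k (max 0 s)"

lemma kp_nonneg [simp]: "0 \<le> kp s"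
  by (simp add: kp_def k_nonneg)

lemma kp_nonpos [simp]: "s \<le> 0 \<Longrightarrow> kp s = 0"
  by (simp add: kp_def k_0)

lemma kp_mono: "s \<le> s' \<Longrightarrow> kp s \<le> kp s'"
  unfolding kp_def using k_less[of "max 0 s" "max 0 s'"]
  by (cases "max 0 s < max 0 s'") (auto simp: max_def not_less split: if_splits)

lemma continuous_on_k: "continuous_on {0..} k"
  unfolding continuous_on_eq_continuous_within
proof
  fix s :: real assume "s \<in> {0..}"
  show "continuous (at s within {0..}) k"
  proof (cases "s = 0")
    case False
    then show ?thesis using \<open>s \<in> {0..}\<close>
      by (intro DERIV_continuous[OF has_field_derivative_at_within[OF k_deriv]]) auto
  next
    case True
    show ?thesis unfolding True continuous_within_eps_delta
    proof (intro allI impI)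
      fix e :: real assume e: "e > 0"
      \<comment> \<open>Differentiability of \<open>k\<close> is given only at positive arguments;
        at 0, monotonicity of \<open>f'\<close> turns \<open>s < f' e\<close> into
        \<open>k s < e\<close>.\<close>
      have "dist (k s) (k 0) < e" if "s \<ge> 0" "s < f' e" for s
        using that f'_mono[of e "k s"] f'_k[of s] k_nonneg[of s] k_0 e by (force simp: dist_real_def)
      then show "\<exists>d>0. \<forall>x'\<in>{0..}. dist x' 0 < d \<longrightarrow> dist (k x') (k 0) < e"
        using f'_pos[OF e] by (intro exI[of _ "f' e"]) (auto simp: dist_real_def)
    qed
  qed
qed

lemma continuous_on_kp: "continuous_on S kp"
proof -
  have "continuous_on UNIV (k \<circ> (\<lambda>s. max 0 s))"
    by (intro continuous_on_compose continuous_intros continuous_on_subset[OF continuous_on_k]) auto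
  then show ?thesis unfolding kp_def comp_def by (rule continuous_on_subset) simp
qed

lemma kp_measurable [measurable]: "kp \<in> borel_measurable borel"
  by (rule borel_measurable_continuous_onI[OF continuous_on_kp])

text \<open>Nothing is assumed about \<open>f\<close> at negative arguments, so measurability is
  stated after clipping at 0.\<close>

lemma f_max_measurable [measurable]: "(\<lambda>t. f (max 0 t)) \<in> borel_measurable borel"
proof (rule borel_measurable_continuous_onI)
  have "continuous_on {0..} f"
    using f_deriv by (auto simp: continuous_on_eq_continuous_within intro: DERIV_continuous)
  then have "continuous_on UNIV (f \<circ> (\<lambda>t. max 0 t))"
    by (intro continuous_on_compose continuous_intros) (auto elim: continuous_on_subset)
  then show "continuous_on UNIV (\<lambda>t. f (max 0 t))" by (simp add: comp_def)
qed

lemma f_comp_measurable: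
  assumes [measurable]: "u \<in> borel_measurable N" and "\<And>x. u x \<ge> 0"
  shows "(\<lambda>x. f (u x)) \<in> borel_measurable N"
proof -
  have "(\<lambda>x. f (max 0 (u x))) \<in> borel_measurable N" by measurable
  then show ?thesis using assms(2) by (simp add: max_absorb2)
qed

text \<open>The convex conjugate of \<open>f\<close> on the half-line, the supremum of
  \<open>s * u - f u\<close> over \<open>u \<ge> 0\<close>, written with its maximiser
  \<open>kp s\<close> so that no supremum has to be handled.\<close>

definition f_star :: "real \<Rightarrow> real" where "f_star s = s * kp s - f (kp s)"

lemma f_star_measurable [measurable]: "f_star \<in> borel_measurable borel"
  unfolding f_star_def by (intro borel_measurable_diff f_comp_measurable) measurable

text \<open>For \<open>s > 0\<close> this is the tangent inequality at \<open>k s\<close>, where the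
  slope of \<open>f\<close> is \<open>s\<close>; otherwise the left side is nonpositive.\<close>

lemma Young: assumes "u \<ge> 0" shows "s * u \<le> f u + f_star s"
proof (cases "s > 0")
  case True
  then show ?thesis using f_tangent[OF k_pos[OF True] assms] f'_k[of s]
    by (simp add: f_star_def kp_def max_absorb2 algebra_simps)
next
  case False
  then have "s * u \<le> 0" using assms by (simp add: mult_nonpos_nonneg)
  then show ?thesis using False f_nonneg[OF assms] by (simp add: f_star_def f_0)
qed

lemma f_star_nonneg [simp]: "0 \<le> f_star s"
  using Young[of 0 s] f_0 by simp

lemma f_star_le: "f_star s \<le> s * kp s"
  using f_nonneg by (simp add: f_star_def)

lemma f_star_nonpos [simp]: "s \<le> 0 \<Longrightarrow> f_star s = 0"
  by (simp add: f_star_def f_0)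

lemma k'_nonneg: assumes "s > 0" shows "k' s \<ge> 0"
proof (rule ccontr)
  assume "\<not> ?thesis"
  then obtain d where d: "d > 0" "\<And>h. 0 < h \<Longrightarrow> h < d \<Longrightarrow> k s > k (s + h)"
    using DERIV_neg_dec_right[OF k_deriv[OF assms]] by auto
  show False using d(2)[of "d / 2"] k_less[of s "s + d / 2"] d(1) assms by auto
qed

text \<open>A pointwise limit of difference quotients of the continuous \<open>kp\<close>. The
  indicator discards the nonpositive arguments, where \<open>k'\<close> is unconstrained.\<close>

lemma k'_measurable [measurable]: "(\<lambda>s. indicator {0<..} s * k' s) \<in> borel_measurable borel"
proof (rule borel_measurable_LIMSEQ_real)
  fix s :: real
  show "(\<lambda>n. indicator {0<..} s * ((kp (s + 1 / Suc n) - kp s) / (1 / Suc n)))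
          \<longlonglongrightarrow> indicator {0<..} s * k' s"
  proof (cases "s > 0")
    case True
    have "((\<lambda>h. (k (s + h) - k s) / h) \<longlongrightarrow> k' s) (at 0)"
      using k_deriv[OF True] by (simp add: DERIV_def)
    moreover have "filterlim (\<lambda>n. 1 / real (Suc n)) (at 0) sequentially"
      using LIMSEQ_inverse_real_of_nat
      by (auto simp: filterlim_at inverse_eq_divide simp del: of_nat_Suc)
    ultimately have "(\<lambda>n. (k (s + 1 / Suc n) - k s) / (1 / Suc n)) \<longlonglongrightarrow> k' s"
      by (rule filterlim_compose)
    then show ?thesis using True by (simp add: kp_def max_absorb2)
  qed simp
qed measurable

text \<open>Clipping both endpoints at 0 replaces \<open>kp\<close> by \<open>k\<close>. The
  fundamental theorem is used in its interior form, since at 0 only continuity of \<open>k\<close>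
  is known.\<close>

lemma nn_integral_k':
  assumes "a \<le> b"
  shows "(\<integral>\<^sup>+ s. ennreal (indicator {0<..} s * k' s) * indicator {a<..<b} s \<partial>lborel) = ennreal (kp b - kp a)"
proof -
  define a' b' where "a' = max 0 a" and "b' = max 0 b"
  have ab: "0 \<le> a'" "a' \<le> b'" using assms by (auto simp: a'_def b'_def)
  have "(k' has_integral (k b' - k a')) {a'..b'}"
  proof (rule fundamental_theorem_of_calculus_interior)
    show "continuous_on {a'..b'} k"
      by (rule continuous_on_subset[OF continuous_on_k]) (use ab in auto)
    show "(k has_vector_derivative k' x) (at x)" if "x \<in> {a'<..<b'}" for x
      using k_deriv[of x] that ab
      by (auto simp: has_real_derivative_iff_has_vector_derivative)
  qed (use ab in auto)
  then have "(k' has_integral (k b' - k a')) {a'<..<b'}"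
    using has_integral_Icc_iff_Ioo by blast
  then have "(\<integral>\<^sup>+ s. ennreal (indicator {a'<..<b'} s * k' s) \<partial>lborel) = ennreal (k b' - k a')"
    using ab by (intro nn_integral_has_integral_lebesgue) (auto simp: k'_nonneg)
  moreover have "ennreal (indicator {a'<..<b'} s * k' s)
      = ennreal (indicator {0<..} s * k' s) * indicator {a<..<b} s" for s
    by (auto simp: a'_def b'_def indicator_def)
  ultimately show ?thesis by (simp add: kp_def a'_def b'_def)
qed

end

section \<open>Radial integrals\<close>

text \<open>Polar coordinates for radial functions: both measures give the half-line up to
  \<open>a\<close> the volume of the ball of radius \<open>a\<close>, and these half-lines generate
  the Borel sets.\<close>

lemma distr_norm_lborel:
  "distr (lborel :: 'a::euclidean_space measure) borel norm =
     density lborel (\<lambda>r. indicator {0..} r *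
       ennreal (real DIM('a) * measure lborel (ball (0::'a) 1) * r ^ (DIM('a) - 1)))"
    (is "?L = ?R")
proof -
  define n \<omega> where "n = DIM('a)" and "\<omega> = measure lborel (ball (0::'a) 1)"
  have n: "n \<ge> 1" by (simp add: n_def Suc_leI)
  have \<omega>: "\<omega> = unit_ball_vol n" "\<omega> \<ge> 0" by (auto simp: n_def \<omega>_def content_ball)
  have ball: "emeasure lborel (cball (0::'a) a) = ennreal (\<omega> * a ^ n)" if "a \<ge> 0" for a
    using emeasure_cball[OF that, of "0::'a"] \<omega> by (simp add: n_def)
  have L: "emeasure ?L {..a} = (if a \<ge> 0 then ennreal (\<omega> * a ^ n) else 0)" for a
  proof -
    have "emeasure ?L {..a} = emeasure lborel (cball (0::'a) a)"
      by (subst emeasure_distr) (auto intro!: arg_cong[where f = "emeasure lborel"])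
    then show ?thesis using ball by auto
  qed
  have R: "emeasure ?R {..a} = (if a \<ge> 0 then ennreal (\<omega> * a ^ n) else 0)" for a
  proof -
    have "emeasure ?R {..a} = (\<integral>\<^sup>+ r. ennreal (real n * \<omega> * r ^ (n - 1)) * indicator {0..a} r \<partial>lborel)"
      by (subst emeasure_density)
         (auto intro!: nn_integral_cong simp: n_def \<omega>_def split: split_indicator)
    also have "\<dots> = (if a \<ge> 0 then ennreal (\<omega> * a ^ n) else 0)"
    proof (cases "a \<ge> 0")
      case True
      have "(\<integral>\<^sup>+ r. ennreal (real n * \<omega> * r ^ (n - 1)) * indicator {0..a} r \<partial>lborel)
          = ennreal (\<omega> * a ^ n - \<omega> * 0 ^ n)"
        by (rule nn_integral_FTC_Icc[where F = "\<lambda>r. \<omega> * r ^ n"])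
           (use True \<omega> in \<open>auto intro!: derivative_eq_intros\<close>)
      then show ?thesis using True n by (simp add: power_0_left)
    qed auto
    finally show ?thesis .
  qed
  show ?thesis
  proof (rule measure_eqI_generator_eq[where E = "range (\<lambda>a::real. {..a})" and \<Omega> = UNIV
        and A = "\<lambda>i. {..real i}"])
    show "Int_stable (range (\<lambda>a::real. {..a}))"
      by (auto simp: Int_stable_def)
    show "sets ?L = sigma_sets UNIV (range (\<lambda>a::real. {..a}))"
      "sets ?R = sigma_sets UNIV (range (\<lambda>a::real. {..a}))"
      by (simp_all add: borel_eq_atMost)
    show "(\<Union>i. {..real i}) = UNIV" by (auto simp: real_arch_simple)
  qed (use L R in auto)
qed

lemma nn_integral_radial:
  fixes \<phi> :: "real \<Rightarrow> ennreal"
  assumes [measurable]: "\<phi> \<in> borel_measurable borel"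
  shows "(\<integral>\<^sup>+ y. \<phi> (norm (y::'a::euclidean_space)) \<partial>lborel) =
    (\<integral>\<^sup>+ r. indicator {0..} r * ennreal (real DIM('a) * measure lborel (ball (0::'a) 1) * r ^ (DIM('a) - 1)) * \<phi> r \<partial>lborel)"
proof -
  have "(\<integral>\<^sup>+ y. \<phi> (norm (y::'a)) \<partial>lborel) = (\<integral>\<^sup>+ r. \<phi> r \<partial>distr (lborel :: 'a measure) borel norm)"
    by (rule nn_integral_distr[symmetric]) auto
  then show ?thesis unfolding distr_norm_lborel
    by (simp add: nn_integral_density)
qed

lemma nn_integral_lborel_shift:
  fixes h :: "'a::euclidean_space \<Rightarrow> ennreal"
  assumes [measurable]: "h \<in> borel_measurable borel"
  shows "(\<integral>\<^sup>+ y. h (y - x) \<partial>lborel) = (\<integral>\<^sup>+ y. h y \<partial>lborel)"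
proof -
  have "(\<integral>\<^sup>+ y. h (y - x) \<partial>distr lborel borel ((+) x)) = (\<integral>\<^sup>+ y. h y \<partial>lborel)"
    by (subst nn_integral_distr) auto
  then show ?thesis by (simp add: lborel_distr_plus)
qed

section \<open>The energy of a single atom\<close>

text \<open>The parameter \<open>w\<close> also fixes the type \<open>'a\<close> and hence the
  dimension, on which \<open>M\<close>, \<open>Phi\<close>, \<open>C\<close> and \<open>E\<close>
  depend although their types do not mention it.\<close>

locale congested_transport = congestion f f' k k' for f f' k k' +
  fixes p :: real and w :: "'a::euclidean_space \<Rightarrow> real"
  assumes p_ge_1: "p \<ge> 1" and w_eq: "w y = norm y powr p"
begin

lemma w_nonneg [simp]: "0 \<le> w y"
  by (simp add: w_eq)

lemma w_measurable [measurable]: "w \<in> borel_measurable borel"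
  unfolding w_eq by measurable

definition rad :: "real \<Rightarrow> real" where "rad c = max 0 c powr (1 / p)"

lemma rad_nonneg [simp]: "0 \<le> rad c"
  by (simp add: rad_def)

lemma norm_less_rad: assumes "w y < c" shows "norm y < rad c"
proof -
  have "norm y = w y powr (1 / p)" using p_ge_1 by (simp add: w_eq powr_powr)
  also have "\<dots> < c powr (1 / p)" using p_ge_1 assms by (intro powr_less_mono2) auto
  also have "c = max 0 c" using assms w_nonneg[of y] by linarith
  finally show ?thesis by (simp add: rad_def)
qed

text \<open>Vanishing of \<open>h\<close> at nonpositive arguments confines the integrand to a ball,
  on which it is bounded.\<close>

lemma integrable_profile:
  assumes [measurable]: "h \<in> borel_measurable borel"
    and "\<And>s. s \<le> 0 \<Longrightarrow> h s = 0" and "\<And>s. s \<le> c \<Longrightarrow> \<bar>h s\<bar> \<le> B"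
  shows "integrable lborel (\<lambda>y. h (c - w y) :: real)"
proof (rule Bochner_Integration.integrable_bound[where f = "\<lambda>y. B * indicator (cball 0 (rad c)) y"])
  have "norm (h (c - w y)) \<le> norm (B * indicator (cball 0 (rad c)) y)" for y
  proof (cases "w y < c")
    case True
    then show ?thesis using norm_less_rad[OF True] assms(3)[of "c - w y"] by auto
  qed (use assms(2) in auto)
  then show "AE y in lborel. norm (h (c - w y)) \<le> norm (B * indicator (cball 0 (rad c)) y)" by simp
qed (auto intro!: integrable_mult_right integrable_real_indicator simp: emeasure_cball)

section \<open>Mass and dual value as functions of the multiplier\<close>

definition M :: "real \<Rightarrow> real" where "M c = (LINT y|lborel. kp (c - w y))"

definition Phi :: "real \<Rightarrow> real" where "Phi c = (LINT y|lborel. f_star (c - w y))"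

lemma integrable_M: "integrable lborel (\<lambda>y. kp (c - w y))"
  by (rule integrable_profile[where B = "kp c"]) (auto simp: kp_mono)

lemma integrable_Phi: "integrable lborel (\<lambda>y. f_star (c - w y))"
proof (rule integrable_profile[where B = "\<bar>c * kp c\<bar>"])
  fix s assume "s \<le> c"
  have "f_star s \<le> \<bar>c * kp c\<bar>"
  proof (cases "s > 0")
    case True
    then have "s * kp s \<le> c * kp c" using \<open>s \<le> c\<close> by (intro mult_mono kp_mono) auto
    then show ?thesis using f_star_le[of s] by linarith
  qed auto
  then show "\<bar>f_star s\<bar> \<le> \<bar>c * kp c\<bar>" by simp
qed auto

lemma nn_integral_M: "(\<integral>\<^sup>+ y. ennreal (kp (c - w (y - x))) \<partial>lborel) = ennreal (M c)"
  unfolding M_def using nn_integral_lborel_shift[of "\<lambda>y. ennreal (kp (c - w y))" x]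
  by (simp add: nn_integral_eq_integral integrable_M)

lemma nn_integral_Phi: "(\<integral>\<^sup>+ y. ennreal (f_star (c - w (y - x))) \<partial>lborel) = ennreal (Phi c)"
  unfolding Phi_def using nn_integral_lborel_shift[of "\<lambda>y. ennreal (f_star (c - w y))" x]
  by (simp add: nn_integral_eq_integral integrable_Phi)

lemma M_nonneg: "0 \<le> M c" and Phi_nonneg: "0 \<le> Phi c"
  by (simp_all add: M_def Phi_def)

lemma M_mono: "c \<le> d \<Longrightarrow> M c \<le> M d"
  unfolding M_def by (intro integral_mono integrable_M kp_mono) simp

lemma M_nonpos: "c \<le> 0 \<Longrightarrow> M c = 0" and Phi_nonpos: "c \<le> 0 \<Longrightarrow> Phi c = 0"
  using w_nonneg by (simp_all add: M_def Phi_def order_trans)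

text \<open>A crude bound with two uses: a small ball gives positivity of \<open>M\<close>, the unit
  ball its unboundedness.\<close>

lemma M_ge:
  assumes "r \<ge> 0"
  shows "measure lborel (ball (0::'a) r) * kp (c - r powr p) \<le> M c"
proof -
  have "(LINT y|lborel. indicator (ball (0::'a) r) y * kp (c - r powr p)) \<le> M c"
    unfolding M_def
  proof (rule integral_mono[OF _ integrable_M])
    show "integrable lborel (\<lambda>y. indicator (ball (0::'a) r) y * kp (c - r powr p))"
      using assms by (intro integrable_mult_left integrable_real_indicator) (auto simp: emeasure_ball)
    fix y :: 'a
    have "w y \<le> r powr p" if "norm y < r"
      using that p_ge_1 by (auto simp: w_eq intro!: powr_mono2)
    then show "indicator (ball 0 r) y * kp (c - r powr p) \<le> kp (c - w y)"
      by (auto simp: indicator_def intro!: kp_mono)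
  qed
  then show ?thesis by simp
qed

lemma M_pos: assumes "c > 0" shows "M c > 0"
proof -
  \<comment> \<open>On the ball of this radius the cost uses up at most half of \<open>c\<close>,
    leaving density at least \<open>k (c / 2) > 0\<close>.\<close>
  define r where "r = (c / 2) powr (1 / p)"
  have r: "r > 0" "r powr p = c / 2" using assms p_ge_1 by (auto simp: r_def powr_powr)
  have "0 < measure lborel (ball (0::'a) r) * kp (c - r powr p)"
    using r assms by (auto simp: content_ball kp_def max_absorb2 k_pos)
  also have "\<dots> \<le> M c" using r by (intro M_ge) simp
  finally show ?thesis .
qed

lemma M_unbounded: obtains c where "c \<ge> 0" "M c \<ge> m"
proof -
  define v where "v = measure lborel (ball (0::'a) 1)"
  have v: "v > 0" by (simp add: v_def content_ball)
  obtain s where s: "s \<ge> 0" "k s > \<bar>m\<bar> / v" using k_unbounded[of "\<bar>m\<bar> / v"] v by auto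
  \<comment> \<open>The cost is at most 1 on the unit ball, so the multiplier \<open>s + 1\<close>
    leaves density at least \<open>k s\<close> there.\<close>
  have "v * kp (s + 1 - 1 powr p) \<le> M (s + 1)" unfolding v_def by (rule M_ge) simp
  moreover have "\<bar>m\<bar> < v * k s" using s v by (simp add: field_simps)
  ultimately have "m \<le> M (s + 1)" using s by (simp add: kp_def max_absorb2)
  then show thesis using that[of "s + 1"] s by auto
qed

lemma isCont_M: "isCont M c"
proof (unfold continuous_at_sequentially, intro allI impI)
  fix X :: "nat \<Rightarrow> real" assume X: "X \<longlonglongrightarrow> c"
  then obtain K where K: "\<And>n. \<bar>X n\<bar> \<le> K"
    using Bseq_def convergent_imp_Bseq convergentI by (metis real_norm_def)
  have "(\<lambda>n. LINT y|lborel. kp (X n - w y)) \<longlonglongrightarrow> (LINT y|lborel. kp (c - w y))"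
  proof (rule integral_dominated_convergence[OF _ _ integrable_M[of K]])
    show "AE y in lborel. (\<lambda>n. kp (X n - w y)) \<longlonglongrightarrow> kp (c - w y)"
    proof (intro AE_I2)
      fix y
      have "isCont kp (c - w y)" using continuous_on_kp[of UNIV] by (simp add: continuous_on_eq_continuous_at)
      then show "(\<lambda>n. kp (X n - w y)) \<longlonglongrightarrow> kp (c - w y)"
        by (rule isCont_tendsto_compose) (intro tendsto_intros X)
    qed
    show "AE y in lborel. norm (kp (X n - w y)) \<le> kp (K - w y)" for n
      using K[of n] by (auto intro!: kp_mono)
  qed measurable
  then show "(M \<circ> X) \<longlonglongrightarrow> M c" by (simp add: M_def comp_def)
qed

lemma ex_M_eq: assumes "m \<ge> 0" shows "\<exists>c\<ge>0. M c = m"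
proof -
  obtain c where c: "c \<ge> 0" "M c \<ge> m" using M_unbounded by blast
  show ?thesis using IVT[of M 0 m c] c assms isCont_M M_nonpos[of 0] by auto
qed

text \<open>The formal derivative of \<open>M\<close>, so the reciprocal of \<open>E''\<close>. As
  an extended nonnegative integral it makes sense without integrability of
  \<open>k'\<close>.\<close>

definition A :: "real \<Rightarrow> ennreal" where
  "A c = (\<integral>\<^sup>+ y. ennreal (indicator {0<..} (c - w y) * k' (c - w y)) \<partial>lborel)"

text \<open>For fixed \<open>y\<close> the increment of the density is the integral of
  \<open>k'\<close> from \<open>a - w y\<close> to \<open>b - w y\<close>; shifting by
  \<open>w y\<close> makes the interval independent of \<open>y\<close>, and then the integrals may
  be exchanged.\<close>

lemma M_diff_eq_nn_integral:
  assumes "a \<le> b"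
  shows "ennreal (M b - M a) = (\<integral>\<^sup>+ s. A s * indicator {a<..<b} s \<partial>lborel)"
proof -
  define q where "q = (\<lambda>s. indicator {0<..} s * k' s)"
  have [measurable]: "q \<in> borel_measurable borel" unfolding q_def by measurable
  have "M b - M a = (LINT y|lborel. kp (b - w y) - kp (a - w y))"
    unfolding M_def by (simp add: integrable_M)
  then have "ennreal (M b - M a) = (\<integral>\<^sup>+ y. ennreal (kp (b - w y) - kp (a - w y)) \<partial>lborel)"
    using assms by (simp add: nn_integral_eq_integral integrable_M kp_mono)
  also have "\<dots> = (\<integral>\<^sup>+ y. (\<integral>\<^sup>+ s. ennreal (q (s - w y)) * indicator {a<..<b} s \<partial>lborel) \<partial>lborel)"
  proof (rule nn_integral_cong)
    fix y
    have "ennreal (kp (b - w y) - kp (a - w y))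
       = (\<integral>\<^sup>+ s. ennreal (q s) * indicator {a - w y<..<b - w y} s \<partial>lborel)"
      unfolding q_def using assms by (intro nn_integral_k'[symmetric]) simp
    also have "\<dots> = (\<integral>\<^sup>+ s. ennreal (q (s - w y)) * indicator {a - w y<..<b - w y} (s - w y) \<partial>lborel)"
      by (rule nn_integral_lborel_shift[symmetric]) measurable
    also have "\<dots> = (\<integral>\<^sup>+ s. ennreal (q (s - w y)) * indicator {a<..<b} s \<partial>lborel)"
      by (intro nn_integral_cong) (auto simp: indicator_def)
    finally show "ennreal (kp (b - w y) - kp (a - w y)) = \<dots>" .
  qed
  also have "\<dots> = (\<integral>\<^sup>+ s. (\<integral>\<^sup>+ y. ennreal (q (s - w y)) * indicator {a<..<b} s \<partial>lborel) \<partial>lborel)"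
    by (rule lborel_pair.Fubini') measurable
  also have "\<dots> = (\<integral>\<^sup>+ s. A s * indicator {a<..<b} s \<partial>lborel)"
    unfolding A_def by (simp add: q_def nn_integral_multc)
  finally show ?thesis .
qed

text \<open>Recognises the argument of \<open>g''\<close> in the limsup condition as the mass for
  the multiplier \<open>R powr p\<close>.\<close>

lemma M_radial:
  assumes "R > 0"
  shows "(LBINT r=0..R. k (R powr p - r powr p) * (real DIM('a) * measure lborel (ball (0::'a) 1)) * r ^ (DIM('a) - 1))
    = M (R powr p)"
proof -
  define \<omega> where "\<omega> = real DIM('a) * measure lborel (ball (0::'a) 1)"
  define q where "q r = indicator {0<..<R} r * (kp (R powr p - r powr p) * \<omega> * r ^ (DIM('a) - 1))" for r
  have \<omega>: "\<omega> \<ge> 0" by (simp add: \<omega>_def)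
  have [measurable]: "q \<in> borel_measurable borel" unfolding q_def by measurable
  have q0: "q r \<ge> 0" for r using \<omega> by (auto simp: q_def indicator_def)
  have "(LBINT r=0..R. k (R powr p - r powr p) * \<omega> * r ^ (DIM('a) - 1)) = (LINT r|lborel. q r)"
    using assms p_ge_1 unfolding interval_lebesgue_integral_def set_lebesgue_integral_def
    by (auto intro!: Bochner_Integration.integral_cong
        simp: q_def indicator_def kp_def zero_ereal_def max_absorb2 powr_mono2)
  moreover have "(\<integral>\<^sup>+ r. ennreal (q r) \<partial>lborel) = ennreal (M (R powr p))"
  proof -
    have "ennreal (M (R powr p)) = (\<integral>\<^sup>+ y. ennreal (kp (R powr p - norm (y::'a) powr p)) \<partial>lborel)"
      using nn_integral_M[of "R powr p" 0] by (simp add: w_eq)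
    also have "\<dots> = (\<integral>\<^sup>+ r. indicator {0..} r * ennreal (\<omega> * r ^ (DIM('a) - 1)) * ennreal (kp (R powr p - r powr p)) \<partial>lborel)"
      unfolding \<omega>_def by (rule nn_integral_radial) measurable
    also have "\<dots> = (\<integral>\<^sup>+ r. ennreal (q r) \<partial>lborel)"
    proof (rule nn_integral_cong_AE)
      \<comment> \<open>The interval integral omits the endpoint 0, which the polar formula
        includes.\<close>
      have "AE r in lborel. r \<noteq> (0::real)" by (rule AE_lborel_singleton)
      then show "AE r in lborel. indicator {0..} r * ennreal (\<omega> * r ^ (DIM('a) - 1)) * ennreal (kp (R powr p - r powr p)) = ennreal (q r)"
      proof eventually_elim
        fix r :: real assume "r \<noteq> 0"
        have "kp (R powr p - r powr p) = 0" if "r \<ge> R"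
          using that assms p_ge_1 by (intro kp_nonpos) (auto intro!: powr_mono2)
        then show "indicator {0..} r * ennreal (\<omega> * r ^ (DIM('a) - 1)) * ennreal (kp (R powr p - r powr p)) = ennreal (q r)"
          using \<omega> \<open>r \<noteq> 0\<close> by (auto simp: q_def indicator_def ennreal_mult[symmetric] mult_ac)
      qed
    qed
    finally show ?thesis by simp
  qed
  ultimately show ?thesis using q0 M_nonneg
    by (simp add: integral_eq_nn_integral \<omega>_def)
qed

lemma A_radial:
  assumes "R > 0"
  shows "(\<integral>\<^sup>+ r. indicator {0..R} r * ennreal (k' (R powr p - r powr p) * (real DIM('a) * measure lborel (ball (0::'a) 1)) * r ^ (DIM('a) - 1)) \<partial>lborel)
    = A (R powr p)"
proof -
  define \<omega> where "\<omega> = real DIM('a) * measure lborel (ball (0::'a) 1)"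
  define q where "q = (\<lambda>s. indicator {0<..} s * k' s)"
  have [measurable]: "q \<in> borel_measurable borel" unfolding q_def by measurable
  have \<omega>: "\<omega> \<ge> 0" by (simp add: \<omega>_def)
  have "A (R powr p) = (\<integral>\<^sup>+ y. ennreal (q (R powr p - norm (y::'a) powr p)) \<partial>lborel)"
    by (simp add: A_def q_def w_eq)
  also have "\<dots> = (\<integral>\<^sup>+ r. indicator {0..} r * ennreal (\<omega> * r ^ (DIM('a) - 1)) * ennreal (q (R powr p - r powr p)) \<partial>lborel)"
    unfolding \<omega>_def by (rule nn_integral_radial) measurable
  also have "\<dots> = (\<integral>\<^sup>+ r. indicator {0..R} r * ennreal (k' (R powr p - r powr p) * \<omega> * r ^ (DIM('a) - 1)) \<partial>lborel)"
  proof (rule nn_integral_cong_AE)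
    \<comment> \<open>At \<open>r = R\<close> the argument of \<open>k'\<close> is 0, where
      \<open>k'\<close> is arbitrary and \<open>q\<close> is 0.\<close>
    have "AE r in lborel. r \<noteq> R" by (rule AE_lborel_singleton)
    then show "AE r in lborel. indicator {0..} r * ennreal (\<omega> * r ^ (DIM('a) - 1)) * ennreal (q (R powr p - r powr p))
        = indicator {0..R} r * ennreal (k' (R powr p - r powr p) * \<omega> * r ^ (DIM('a) - 1))"
    proof eventually_elim
      fix r assume "r \<noteq> R"
      have neg: "R powr p - r powr p \<le> 0" if "r \<ge> R"
        using that assms p_ge_1 by (auto intro!: powr_mono2)
      have pos: "R powr p - r powr p > 0" if "0 \<le> r" "r < R"
        using that assms p_ge_1 by (auto intro!: powr_less_mono2)
      consider "r < 0" | "0 \<le> r" "r < R" | "r > R" using \<open>r \<noteq> R\<close> by linarith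
      then show "indicator {0..} r * ennreal (\<omega> * r ^ (DIM('a) - 1)) * ennreal (q (R powr p - r powr p))
        = indicator {0..R} r * ennreal (k' (R powr p - r powr p) * \<omega> * r ^ (DIM('a) - 1))"
      proof cases
        case 2
        then show ?thesis using pos k'_nonneg \<omega>
          by (simp add: q_def ennreal_mult[symmetric] mult_ac)
      qed (use neg assms in \<open>auto simp: q_def\<close>)
    qed
  qed
  finally show ?thesis by (simp add: \<omega>_def)
qed

text \<open>\<open>C m\<close> is the Lagrange multiplier of an optimal density of mass \<open>m\<close> around an atom,
  and \<open>E m\<close> is the resulting minimal cost of transport and congestion.\<close>

definition C :: "real \<Rightarrow> real" where "C m = (SOME c. c \<ge> 0 \<and> M c = m)"

definition E :: "real \<Rightarrow> real" where "E m = C m * m - Phi (C m)"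

lemma C_nonneg: "m \<ge> 0 \<Longrightarrow> 0 \<le> C m" and M_C: "m \<ge> 0 \<Longrightarrow> M (C m) = m"
  using someI_ex[of "\<lambda>c. c \<ge> 0 \<and> M c = m"] ex_M_eq[of m] by (auto simp: C_def)

text \<open>Monotonicity of \<open>M\<close> suffices for strictness, whichever preimages of
  \<open>m\<close> and \<open>m'\<close> were chosen.\<close>

lemma C_less: "0 \<le> m \<Longrightarrow> m < m' \<Longrightarrow> C m < C m'"
  using M_mono[of "C m'" "C m"] M_C[of m] M_C[of m'] by force

lemma C_0: "C 0 = 0"
  using M_pos[of "C 0"] M_C[of 0] C_nonneg[of 0] by force

lemma E_0: "E 0 = 0"
  by (simp add: E_def C_0 Phi_nonpos)

text \<open>Pointwise this is Young's inequality with slope \<open>d - w y\<close> at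
  \<open>kp (c - w y)\<close>, the very point that gives equality for the slope
  \<open>c - w y\<close>.\<close>

lemma Phi_subgradient: "(d - c) * M c \<le> Phi d - Phi c"
proof -
  have "(LINT y|lborel. (d - c) * kp (c - w y)) \<le> (LINT y|lborel. f_star (d - w y) - f_star (c - w y))"
  proof (rule integral_mono)
    fix y
    have "(d - w y) * kp (c - w y) \<le> f (kp (c - w y)) + f_star (d - w y)" by (rule Young) simp
    then show "(d - c) * kp (c - w y) \<le> f_star (d - w y) - f_star (c - w y)"
      by (simp add: f_star_def[of "c - w y"] algebra_simps)
  qed (use integrable_M integrable_Phi in auto)
  then show ?thesis by (simp add: M_def Phi_def integrable_Phi)
qed

text \<open>Exhibits \<open>E\<close> as the conjugate of \<open>Phi\<close>, the maximum being
  attained at \<open>d = C m\<close>.\<close>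

lemma E_ge: "m \<ge> 0 \<Longrightarrow> d * m - Phi d \<le> E m"
  using Phi_subgradient[of d "C m"] M_C[of m] by (simp add: E_def algebra_simps)

lemma E_nonneg: "m \<ge> 0 \<Longrightarrow> 0 \<le> E m"
  using E_ge[of m 0] Phi_nonpos[of 0] by simp

text \<open>\<open>C m'\<close> is a subgradient of \<open>E\<close> at \<open>m'\<close>. Used with
  the two masses in either order, this traps difference quotients of \<open>E\<close> between values
  of \<open>C\<close>.\<close>

lemma E_diff_le: "m \<ge> 0 \<Longrightarrow> E m' - E m \<le> C m' * (m' - m)"
  using E_ge[of m "C m'"] by (simp add: E_def algebra_simps)

text \<open>All subgradients on the interval lie between 0 and \<open>C B\<close>, which is
  therefore a Lipschitz constant.\<close>

lemma continuous_on_E: "continuous_on {0..B} E"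
proof -
  have *: "\<bar>E x - E y\<bar> \<le> C B * \<bar>x - y\<bar>" if "0 \<le> x" "x \<le> y" "y \<le> B" for x y
  proof -
    have "C x * (y - x) \<le> E y - E x" using E_diff_le[of y x] that by (simp add: algebra_simps)
    moreover have "0 \<le> C x * (y - x)" using that C_nonneg by simp
    moreover have "C y * (y - x) \<le> C B * (y - x)"
      using that C_less[of y B] by (intro mult_right_mono) (cases "y = B", auto)
    ultimately show ?thesis using E_diff_le[of x y] that by simp
  qed
  show ?thesis
  proof (cases "B \<ge> 0")
    case True
    have "(C B)-lipschitz_on {0..B} E"
    proof (rule lipschitz_onI)
      show "dist (E x) (E y) \<le> C B * dist x y" if "x \<in> {0..B}" "y \<in> {0..B}" for x y
        using *[of x y] *[of y x] that by (cases "x \<le> y") (auto simp: dist_real_def abs_minus_commute)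
    qed (use True C_nonneg in auto)
    then show ?thesis by (rule lipschitz_on_continuous_on)
  qed simp
qed

section \<open>Concavity of transport, congestion and atomic cost near zero mass\<close>

lemma multiplier_plus_slope_antimono:
  fixes g' g'' :: "real \<Rightarrow> real"
  assumes "\<beta> > 1" and "M \<epsilon> < 1"
    and g'_deriv: "\<And>m. 0 < m \<Longrightarrow> m < 1 \<Longrightarrow> (g' has_real_derivative g'' m) (at m)"
    and g''_cont: "\<And>m. 0 < m \<Longrightarrow> m < 1 \<Longrightarrow> isCont g'' m"
    and g''_neg: "\<And>s. 0 < s \<Longrightarrow> s < \<epsilon> \<Longrightarrow> g'' (M s) < 0"
    and A_ge: "\<And>s. 0 < s \<Longrightarrow> s < \<epsilon> \<Longrightarrow> ennreal (\<beta> / (- g'' (M s))) \<le> A s"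
    and cd: "0 < c" "c \<le> d" "d < \<epsilon>"
  shows "g' (M d) + d \<le> g' (M c) + c"
  \<comment> \<open>Formally the derivative of \<open>g' (M c) + c\<close> is
    \<open>g'' (M c) * A c + 1\<close>, negative because \<open>A\<close> is at least
    \<open>\<beta>\<close> over \<open>- g''\<close>. As no regularity of \<open>A\<close> is
    available, the inequality is proved on short intervals around each point and spread by
    bisection, the relation being transitive.\<close>
  using cd(2)
proof (induction rule: Bolzano)
  case (local x)
  then have x: "0 < x" "x < \<epsilon>" using cd by auto
  \<comment> \<open>\<open>e\<close> solves \<open>\<beta> * (G - e) = G + e\<close>. If
    \<open>g''\<close> stays within \<open>e\<close> of \<open>- G\<close>, the increment of
    \<open>M\<close> is at least \<open>\<beta> / (G + e)\<close> per unit and \<open>g'\<close>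
    falls at rate at least \<open>G - e\<close>, which makes exactly 1 in total.\<close>
  define G e where "G = - g'' (M x)" and "e = G * (\<beta> - 1) / (\<beta> + 1)"
  have G: "G > 0" using g''_neg[OF x] by (simp add: G_def)
  have e: "e > 0" using G \<open>\<beta> > 1\<close> by (simp add: e_def)
  have Ge: "\<beta> * (G - e) = G + e" using \<open>\<beta> > 1\<close> by (simp add: e_def field_simps)
  have "G + e > 0" using G e by simp
  then have "G - e > 0" using Ge \<open>\<beta> > 1\<close> by (metis zero_less_mult_pos less_trans zero_less_one)
  have Mx: "0 < M x" "M x < 1" using M_pos[of x] x M_mono[of x \<epsilon>] assms(2) by auto
  then obtain \<rho> where \<rho>: "\<rho> > 0" "\<And>m. \<bar>m - M x\<bar> < \<rho> \<Longrightarrow> \<bar>g'' m + G\<bar> < e"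
    using g''_cont[OF Mx] e unfolding continuous_at_eps_delta G_def dist_real_def by force
  obtain \<tau> where \<tau>: "\<tau> > 0" "\<And>s. \<bar>s - x\<bar> < \<tau> \<Longrightarrow> \<bar>M s - M x\<bar> < \<rho>"
    using isCont_M[of x] \<rho>(1) unfolding continuous_at_eps_delta dist_real_def by blast
  show ?case
  \<comment> \<open>Intervals this short stay inside \<open>{0<..<\<epsilon>}\<close> and keep
    \<open>M\<close> where \<open>g''\<close> is under control.\<close>
  proof (intro exI[of _ "min \<tau> (min x (\<epsilon> - x))"] conjI allI impI)
    show "0 < min \<tau> (min x (\<epsilon> - x))" using \<tau> x by simp
    fix a b assume ab: "a \<le> x \<and> x \<le> b \<and> b - a < min \<tau> (min x (\<epsilon> - x))"
    then have ab': "0 < a" "b < \<epsilon>" by auto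
    show "g' (M b) + b \<le> g' (M a) + a"
    proof (cases "a = b")
      case False
      then have "a < b" using ab by simp
      have "ennreal (\<beta> / (G + e) * (b - a)) = (\<integral>\<^sup>+ s. ennreal (\<beta> / (G + e)) * indicator {a<..<b} s \<partial>lborel)"
        using \<open>a < b\<close> \<open>\<beta> > 1\<close> \<open>G + e > 0\<close> by (simp add: nn_integral_cmult_indicator ennreal_mult[symmetric])
      also have "\<dots> \<le> (\<integral>\<^sup>+ s. A s * indicator {a<..<b} s \<partial>lborel)"
      proof (rule nn_integral_mono)
        fix s
        show "ennreal (\<beta> / (G + e)) * indicator {a<..<b} s \<le> A s * indicator {a<..<b} s"
        proof (cases "s \<in> {a<..<b}")
          case True
          then have s: "0 < s" "s < \<epsilon>" using ab' by auto
          have "\<bar>s - x\<bar> < \<tau>" using True ab by auto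
          then have "\<bar>g'' (M s) + G\<bar> < e" using \<tau> \<rho> by blast
          then have "- g'' (M s) \<le> G + e" by linarith
          then have "\<beta> / (G + e) \<le> \<beta> / (- g'' (M s))"
            using g''_neg[OF s] \<open>\<beta> > 1\<close> by (intro divide_left_mono) (auto intro!: mult_pos_neg \<open>G + e > 0\<close>)
          then have "ennreal (\<beta> / (G + e)) \<le> A s"
            using A_ge[OF s] ennreal_leI order_trans by blast
          then show ?thesis using True by simp
        qed simp
      qed
      also have "\<dots> = ennreal (M b - M a)"
        using M_diff_eq_nn_integral[of a b] \<open>a < b\<close> by simp
      finally have step: "\<beta> / (G + e) * (b - a) \<le> M b - M a"
        using M_mono[of a b] \<open>a < b\<close> by (subst (asm) ennreal_le_iff) auto
      moreover have "0 < \<beta> / (G + e) * (b - a)" using \<open>a < b\<close> \<open>\<beta> > 1\<close> \<open>G + e > 0\<close> by simp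
      ultimately have "M a < M b" by linarith
      have Mab: "0 < M a" "M b < 1" using M_pos[of a] ab' M_mono[of b \<epsilon>] assms(2) by auto
      obtain \<xi> where \<xi>: "M a < \<xi>" "\<xi> < M b" "g' (M b) - g' (M a) = (M b - M a) * g'' \<xi>"
        using MVT2[OF \<open>M a < M b\<close>, of g' g''] g'_deriv Mab by (metis less_le_trans le_less_trans)
      have "\<bar>M a - M x\<bar> < \<rho>" "\<bar>M b - M x\<bar> < \<rho>" using \<tau>(2)[of a] \<tau>(2)[of b] ab by auto
      then have "\<bar>\<xi> - M x\<bar> < \<rho>" using \<xi> by auto
      then have "g'' \<xi> \<le> - (G - e)" using \<rho>(2)[of \<xi>] by linarith
      then have "(M b - M a) * g'' \<xi> \<le> (M b - M a) * (- (G - e))"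
        using \<open>M a < M b\<close> by (intro mult_left_mono) auto
      also have "\<dots> \<le> \<beta> / (G + e) * (b - a) * (- (G - e))"
        using step \<open>G - e > 0\<close> by (intro mult_right_mono_neg) auto
      also have "\<dots> = - (\<beta> * (G - e) / (G + e) * (b - a))"
        using \<open>G + e > 0\<close> by (simp add: field_simps)
      also have "\<dots> = - (b - a)" unfolding Ge using \<open>G + e > 0\<close> by simp
      finally show ?thesis using \<xi>(3) by simp
    qed simp
  qed
qed simp

text \<open>\<open>E + g\<close> has the nonincreasing derivative \<open>C m + g' m\<close>, so its
  increment over a step of length \<open>b\<close> does not grow with the starting point. Comparing
  the starting points \<open>a\<close> and 0 suffices, as \<open>E + g\<close> vanishes at
  0.\<close>

lemma E_plus_g_subadditive_near_0:
  fixes g g' g'' :: "real \<Rightarrow> real"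
  assumes "\<beta> > 1" and \<epsilon>: "0 < \<epsilon>" "M \<epsilon> < 1"
    and g0: "g 0 = 0" and g_cont: "continuous_on {0..1} g"
    and g_deriv: "\<And>m. 0 < m \<Longrightarrow> m < 1 \<Longrightarrow> (g has_real_derivative g' m) (at m)"
    and g'_deriv: "\<And>m. 0 < m \<Longrightarrow> m < 1 \<Longrightarrow> (g' has_real_derivative g'' m) (at m)"
    and g''_cont: "\<And>m. 0 < m \<Longrightarrow> m < 1 \<Longrightarrow> isCont g'' m"
    and g''_neg: "\<And>s. 0 < s \<Longrightarrow> s < \<epsilon> \<Longrightarrow> g'' (M s) < 0"
    and A_ge: "\<And>s. 0 < s \<Longrightarrow> s < \<epsilon> \<Longrightarrow> ennreal (\<beta> / (- g'' (M s))) \<le> A s"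
    and ab: "0 \<le> a" "0 \<le> b" "a + b < M \<epsilon>"
  shows "E (a + b) + g (a + b) \<le> E a + g a + (E b + g b)"
proof (cases "a = 0 \<or> b = 0")
  case True
  then show ?thesis using E_0 g0 by auto
next
  case False
  then have pos: "a > 0" "b > 0" using ab by auto
  let ?\<delta> = "M \<epsilon>"
  have C_lt: "C m < \<epsilon>" if "0 < m" "m < ?\<delta>" for m
    using that M_C[of m] M_mono[of \<epsilon> "C m"] by force
  have anti: "C m' + g' m' \<le> C m + g' m" if "0 < m" "m \<le> m'" "m' < ?\<delta>" for m m'
  proof (cases "m = m'")
    case False
    have "0 < C m" "C m < C m'" "C m' < \<epsilon>"
      using C_less[of 0 m] C_less[of m m'] C_0 C_lt[of m'] that False by auto
    then have "g' (M (C m')) + C m' \<le> g' (M (C m)) + C m"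
      by (intro multiplier_plus_slope_antimono[OF assms(1) \<epsilon>(2) g'_deriv g''_cont g''_neg A_ge]) auto
    then show ?thesis using M_C that by simp
  qed simp
  \<comment> \<open>\<open>C\<close> increases while \<open>C + g'\<close> does not, so
    \<open>C\<close> varies by no more than the continuous \<open>g'\<close>.\<close>
  have C_cont: "isCont C m" if m: "0 < m" "m < ?\<delta>" for m
  proof -
    have "((\<lambda>x. C x - C m) \<longlongrightarrow> 0) (at m)"
    proof (rule Lim_null_comparison)
      have "eventually (\<lambda>x. x \<in> {0<..<?\<delta>}) (at m)"
        using m by (intro eventually_at_in_open') auto
      then show "\<forall>\<^sub>F x in at m. norm (C x - C m) \<le> \<bar>g' x - g' m\<bar>"
      proof eventually_elim
        case (elim x)
        show ?case
          using anti[of x m] anti[of m x] C_less[of x m] C_less[of m x] elim m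
          by (cases x m rule: linorder_cases) auto
      qed
      have "isCont g' m" using g'_deriv[of m] m \<epsilon> by (auto intro: DERIV_isCont)
      then have "((\<lambda>x. g' x - g' m) \<longlongrightarrow> 0) (at m)"
        by (simp add: isCont_def LIM_zero_iff)
      then show "((\<lambda>x. \<bar>g' x - g' m\<bar>) \<longlongrightarrow> 0) (at m)" by (rule tendsto_rabs_zero)
    qed
    then show ?thesis by (simp add: isCont_def LIM_zero_iff)
  qed
  \<comment> \<open>The subgradient inequalities at \<open>m\<close> and at \<open>x\<close> enclose
    the difference quotient between \<open>C m\<close> and \<open>C x\<close>.\<close>
  have E_deriv: "(E has_real_derivative C m) (at m)" if m: "0 < m" "m < ?\<delta>" for m
    unfolding has_field_derivative_iff
  proof (rule LIM_zero_cancel, rule Lim_null_comparison)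
    have "eventually (\<lambda>x. x \<in> {0<..<?\<delta>} - {m}) (at m)"
      using m by (intro eventually_at_in_open) auto
    then show "\<forall>\<^sub>F x in at m. norm ((E x - E m) / (x - m) - C m) \<le> \<bar>C x - C m\<bar>"
    proof eventually_elim
      case (elim x)
      have 1: "C m * (x - m) \<le> E x - E m" using E_diff_le[of x m] elim by (simp add: algebra_simps)
      have 2: "E x - E m \<le> C x * (x - m)" using E_diff_le[of m x] m by simp
      show ?case
      proof (cases "x > m")
        case True
        then have "C m \<le> (E x - E m) / (x - m)" "(E x - E m) / (x - m) \<le> C x"
          using 1 2 by (auto simp: field_simps)
        then show ?thesis by auto
      next
        case False
        then have "x < m" using elim by auto
        then have "C m \<ge> (E x - E m) / (x - m)" "(E x - E m) / (x - m) \<ge> C x"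
          using 1 2 by (auto simp: field_simps)
        then show ?thesis by auto
      qed
    qed
    show "((\<lambda>x. \<bar>C x - C m\<bar>) \<longlongrightarrow> 0) (at m)"
      using C_cont[OF m] by (intro tendsto_rabs_zero) (simp add: isCont_def LIM_zero_iff)
  qed
  define h where "h m = E m + g m" for m
  have h_deriv: "(h has_real_derivative (C m + g' m)) (at m)" if "0 < m" "m < ?\<delta>" for m
    unfolding h_def using that E_deriv g_deriv \<epsilon> by (intro DERIV_add) auto
  have h_cont: "continuous_on {0..1} h"
    unfolding h_def by (intro continuous_intros continuous_on_E g_cont)
  have "h (a + b) - h a \<le> h (0 + b) - h 0"
  proof (rule DERIV_nonpos_imp_decreasing_open[where f = "\<lambda>s. h (s + b) - h s"])
    fix s assume s: "0 < s" "s < a"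
    have "((\<lambda>s. h (s + b)) has_real_derivative (C (s + b) + g' (s + b))) (at s)"
      using h_deriv[of "s + b"] s ab pos by (simp add: DERIV_shift)
    then have "((\<lambda>s. h (s + b) - h s) has_real_derivative (C (s + b) + g' (s + b) - (C s + g' s))) (at s)"
      using s ab pos by (intro DERIV_diff h_deriv) auto
    moreover have "C (s + b) + g' (s + b) - (C s + g' s) \<le> 0"
      using anti[of s "s + b"] s ab pos by simp
    ultimately show "\<exists>y. ((\<lambda>s. h (s + b) - h s) has_real_derivative y) (at s) \<and> y \<le> 0" by blast
  next
    show "continuous_on {0..a} (\<lambda>s. h (s + b) - h s)"
    proof (intro continuous_intros)
      have "continuous_on {0..a} (h \<circ> (\<lambda>s. s + b))"
        using ab \<epsilon> by (intro continuous_on_compose continuous_intros continuous_on_subset[OF h_cont]) auto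
      then show "continuous_on {0..a} (\<lambda>s. h (s + b))" by (simp add: comp_def)
      show "continuous_on {0..a} h" using ab \<epsilon> by (intro continuous_on_subset[OF h_cont]) auto
    qed
  qed (use pos in auto)
  then show ?thesis using E_0 g0 by (simp add: h_def)
qed

end

section \<open>The lower bound\<close>

context congested_transport
begin

text \<open>\<open>Fen\<close> evaluates a density picked by choice; any two densities agree almost
  everywhere.\<close>

lemma Fen_density:
  assumes [measurable]: "u \<in> borel_measurable lborel" and u: "\<And>x. 0 \<le> u x"
    and \<mu>: "\<mu> = density lborel (\<lambda>x::'a. ennreal (u x))"
  shows "Fen f \<mu> = (\<integral>\<^sup>+ x. ennreal (f (u x)) \<partial>lborel)"
proof -
  define P where "P v \<longleftrightarrow> v \<in> borel_measurable lborel \<and> (\<forall>x. 0 \<le> v x) \<and>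
    \<mu> = density lborel (\<lambda>x. ennreal (v x))" for v
  define v where "v = (SOME v. P v)"
  have Pu: "P u" using u \<mu> by (simp add: P_def)
  then have v: "P v" unfolding v_def by (rule someI[of P])
  then have [measurable]: "v \<in> borel_measurable lborel" by (simp add: P_def)
  have "AE x in lborel. ennreal (u x) = ennreal (v x)"
  proof (rule sigma_finite_measure.density_unique[OF sigma_finite_lborel])
    show "density lborel (\<lambda>x. ennreal (u x)) = density lborel (\<lambda>x. ennreal (v x))"
      using v unfolding P_def \<mu> by blast
  qed measurable
  then have "AE x in lborel. ennreal (f (v x)) = ennreal (f (u x))"
  proof eventually_elim
    case (elim x)
    then show ?case using u v by (simp add: P_def)
  qed
  then have "(\<integral>\<^sup>+ x. ennreal (f (v x)) \<partial>lborel) = (\<integral>\<^sup>+ x. ennreal (f (u x)) \<partial>lborel)"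
    by (rule nn_integral_cong_AE)
  moreover have "Fen f \<mu> = (\<integral>\<^sup>+ x. ennreal (f (v x)) \<partial>lborel)"
    using Pu unfolding Fen_def P_def[symmetric] v_def by auto
  ultimately show ?thesis by simp
qed

text \<open>Young's inequality for the potential \<open>max\<^sub>x (c x - |\<cdot> - x|\<^sup>p)\<^sup>+\<close>, whose conjugate
  integrates to at most \<open>\<Sum>x. Phi (c x)\<close>; the plan need not be disintegrated.\<close>

lemma plan_lower_bound:
  assumes \<gamma>: "\<gamma> \<in> plans \<mu> \<nu>"
    and [measurable]: "u \<in> borel_measurable lborel" and u: "\<And>x. 0 \<le> u x"
    and \<mu>: "\<mu> = density lborel (\<lambda>x::'a. ennreal (u x))"
    and I: "finite I" and c: "\<And>x. x \<in> I \<Longrightarrow> 0 \<le> c x"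
  shows "ennreal (\<Sum>x\<in>I. c x * measure \<nu> {x}) \<le>
    (\<integral>\<^sup>+ z. ennreal (w (fst z - snd z)) \<partial>\<gamma>) + (\<integral>\<^sup>+ x. ennreal (f (u x)) \<partial>lborel) + ennreal (\<Sum>x\<in>I. Phi (c x))"
proof -
  have [measurable]: "(\<lambda>x. f (u x)) \<in> borel_measurable lborel"
    by (rule f_comp_measurable) (use u in auto)
  interpret prob_space \<gamma> using \<gamma> by (simp add: plans_def)
  have sets_\<gamma> [measurable_cong]: "sets \<gamma> = sets (borel \<Otimes>\<^sub>M borel)" using \<gamma> by (simp add: plans_def)
  have fst_\<gamma>: "distr \<gamma> borel fst = \<mu>" and snd_\<gamma>: "distr \<gamma> borel snd = \<nu>" using \<gamma> by (auto simp: plans_def)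
  \<comment> \<open>\<open>ennreal\<close> sends negative numbers to 0, so this is a maximum of
    positive parts, and 0 if \<open>I\<close> is empty.\<close>
  define \<psi> where "\<psi> y = (SUP x\<in>I. ennreal (c x - w (y - x)))" for y
  have [measurable]: "\<psi> \<in> borel_measurable borel"
    unfolding \<psi>_def using I by (intro borel_measurable_SUP countable_finite) measurable
  have [measurable]: "{x} \<in> sets borel" for x :: 'a by simp
  have "ennreal (\<Sum>x\<in>I. c x * measure \<nu> {x}) = (\<Sum>x\<in>I. ennreal (c x) * emeasure \<gamma> (snd -` {x} \<inter> space \<gamma>))"
  proof -
    have "ennreal (measure \<nu> {x}) = emeasure \<gamma> (snd -` {x} \<inter> space \<gamma>)" for x
      using measure_distr[of snd \<gamma> borel "{x}"] unfolding snd_\<gamma> by (simp add: emeasure_eq_measure)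
    then show ?thesis using c I by (subst sum_ennreal[symmetric]) (auto simp: ennreal_mult')
  qed
  also have "\<dots> = (\<integral>\<^sup>+ z. (\<Sum>x\<in>I. ennreal (c x) * indicator (snd -` {x} \<inter> space \<gamma>) z) \<partial>\<gamma>)"
    by (subst nn_integral_sum) (auto intro!: sum.cong simp: nn_integral_cmult_indicator)
  also have "\<dots> \<le> (\<integral>\<^sup>+ z. ennreal (w (fst z - snd z)) + \<psi> (fst z) \<partial>\<gamma>)"
  proof (rule nn_integral_mono)
    fix z assume z: "z \<in> space \<gamma>"
    show "(\<Sum>x\<in>I. ennreal (c x) * indicator (snd -` {x} \<inter> space \<gamma>) z) \<le> ennreal (w (fst z - snd z)) + \<psi> (fst z)"
    proof (cases "snd z \<in> I")
      case True
      have "(\<Sum>x\<in>I. ennreal (c x) * indicator (snd -` {x} \<inter> space \<gamma>) z) = (\<Sum>x\<in>I. if x = snd z then ennreal (c x) else 0)"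
        using z by (intro sum.cong) (auto simp: indicator_def)
      also have "\<dots> = ennreal (c (snd z))" using True I by simp
      also have "\<dots> \<le> ennreal (w (fst z - snd z)) + ennreal (c (snd z) - w (fst z - snd z))"
      proof (cases "c (snd z) \<ge> w (fst z - snd z)")
        case True
        then show ?thesis by (simp add: ennreal_plus[symmetric] del: ennreal_plus)
      next
        case False
        then show ?thesis by (auto intro: add_increasing2 ennreal_leI)
      qed
      also have "\<dots> \<le> ennreal (w (fst z - snd z)) + \<psi> (fst z)"
        unfolding \<psi>_def using True by (intro add_left_mono SUP_upper)
      finally show ?thesis .
    next
      case False
      then show ?thesis by (auto simp: sum.neutral indicator_def)
    qed
  qed
  also have "\<dots> = (\<integral>\<^sup>+ z. ennreal (w (fst z - snd z)) \<partial>\<gamma>) + (\<integral>\<^sup>+ z. \<psi> (fst z) \<partial>\<gamma>)"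
    by (rule nn_integral_add) measurable
  also have "(\<integral>\<^sup>+ z. \<psi> (fst z) \<partial>\<gamma>) = (\<integral>\<^sup>+ y. ennreal (u y) * \<psi> y \<partial>lborel)"
  proof -
    have "(\<integral>\<^sup>+ z. \<psi> (fst z) \<partial>\<gamma>) = (\<integral>\<^sup>+ y. \<psi> y \<partial>\<mu>)"
      unfolding fst_\<gamma>[symmetric] by (subst nn_integral_distr) auto
    then show ?thesis unfolding \<mu> by (simp add: nn_integral_density)
  qed
  also have "\<dots> \<le> (\<integral>\<^sup>+ y. ennreal (f (u y)) + (\<Sum>x\<in>I. ennreal (f_star (c x - w (y - x)))) \<partial>lborel)"
  proof (rule nn_integral_mono)
    fix y
    have "ennreal (u y) * \<psi> y = (SUP x\<in>I. ennreal (u y) * ennreal (c x - w (y - x)))"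
      unfolding \<psi>_def by (rule SUP_mult_left_ennreal)
    also have "\<dots> \<le> ennreal (f (u y)) + (\<Sum>x\<in>I. ennreal (f_star (c x - w (y - x))))"
    proof (rule SUP_least)
      fix x assume x: "x \<in> I"
      have "ennreal (u y) * ennreal (c x - w (y - x)) = ennreal (u y * (c x - w (y - x)))"
        using u by (simp add: ennreal_mult')
      also have "\<dots> \<le> ennreal (f (u y) + f_star (c x - w (y - x)))"
        using Young[OF u, of "c x - w (y - x)" y] by (intro ennreal_leI) (simp add: mult.commute)
      also have "\<dots> = ennreal (f (u y)) + ennreal (f_star (c x - w (y - x)))"
        using f_nonneg u by simp
      \<comment> \<open>Bounding one conjugate by the sum of all decouples the atoms. Nothing is
        lost when their supports are disjoint, as they are for the minimiser.\<close>
      also have "\<dots> \<le> ennreal (f (u y)) + (\<Sum>x\<in>I. ennreal (f_star (c x - w (y - x))))"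
        using I x by (intro add_left_mono member_le_sum) auto
      finally show "ennreal (u y) * ennreal (c x - w (y - x)) \<le> \<dots>" .
    qed
    finally show "ennreal (u y) * \<psi> y \<le> ennreal (f (u y)) + (\<Sum>x\<in>I. ennreal (f_star (c x - w (y - x))))" .
  qed
  also have "\<dots> = (\<integral>\<^sup>+ y. ennreal (f (u y)) \<partial>lborel) + (\<Sum>x\<in>I. ennreal (Phi (c x)))"
    by (simp add: nn_integral_add nn_integral_sum nn_integral_Phi del: sum_ennreal)
  also have "(\<Sum>x\<in>I. ennreal (Phi (c x))) = ennreal (\<Sum>x\<in>I. Phi (c x))"
    using Phi_nonneg by (simp add: sum_ennreal)
  finally show ?thesis by (simp add: add.assoc add_left_mono)
qed

text \<open>The dual bound is applied with each potential height chosen as the multiplier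
  \<open>C\<close> of the mass at that atom, which makes it sharp.\<close>

lemma transport_plus_congestion_ge:
  assumes "finite I"
  shows "ennreal (\<Sum>x\<in>I. E (measure \<nu> {x})) \<le> Tp p \<mu> \<nu> + Fen f (\<mu> :: 'a measure)"
proof (cases "Fen f \<mu> = \<infinity>")
  case False
  then obtain u where u: "u \<in> borel_measurable lborel" "\<And>x. 0 \<le> u x"
    "\<mu> = density lborel (\<lambda>x. ennreal (u x))"
    unfolding Fen_def by (auto split: if_splits)
  define c where "c x = C (measure \<nu> {x})" for x
  have c: "c x \<ge> 0" for x by (simp add: c_def C_nonneg)
  have E: "(\<Sum>x\<in>I. E (measure \<nu> {x})) = (\<Sum>x\<in>I. c x * measure \<nu> {x}) - (\<Sum>x\<in>I. Phi (c x))"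
    by (simp add: E_def c_def sum_subtractf)
  \<comment> \<open>\<open>Fen f \<mu>\<close> is finite here and can be moved to the left, so that
    the infimum is bounded plan by plan.\<close>
  have "ennreal (\<Sum>x\<in>I. E (measure \<nu> {x})) - Fen f \<mu> \<le> Tp p \<mu> \<nu>"
    unfolding Tp_def
  proof (rule INF_greatest)
    fix \<gamma> assume \<gamma>: "\<gamma> \<in> plans \<mu> \<nu>"
    define X where "X = (\<integral>\<^sup>+ z. ennreal (norm (fst z - snd z) powr p) \<partial>\<gamma>) + Fen f \<mu>"
    have "ennreal (\<Sum>x\<in>I. c x * measure \<nu> {x}) \<le> X + ennreal (\<Sum>x\<in>I. Phi (c x))"
      using plan_lower_bound[OF \<gamma> u assms c] Fen_density[OF u] by (simp add: X_def w_eq)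
    then have "ennreal (\<Sum>x\<in>I. E (measure \<nu> {x})) \<le> X"
    proof (cases X)
      case (real r)
      have "0 \<le> (\<Sum>x\<in>I. Phi (c x))" by (simp add: sum_nonneg Phi_nonneg)
      then show ?thesis
        using \<open>_ \<le> X + _\<close> real unfolding E
        by (simp add: ennreal_plus[symmetric] ennreal_le_iff del: ennreal_plus)
    qed simp
    then show "ennreal (\<Sum>x\<in>I. E (measure \<nu> {x})) - Fen f \<mu> \<le> (\<integral>\<^sup>+ z. ennreal (norm (fst z - snd z) powr p) \<partial>\<gamma>)"
      using False by (simp add: X_def ennreal_minus_le_iff add.commute)
  qed
  then show ?thesis using False by (simp add: ennreal_minus_le_iff add.commute)
qed simp

lemma Fp_ge_finite_atoms:
  assumes I: "finite I" "I \<subseteq> {x. measure \<nu> {x} \<noteq> 0}"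
    and \<nu>: "prob_space (\<nu> :: 'a measure)" and g: "\<And>t. 0 \<le> t \<Longrightarrow> t \<le> 1 \<Longrightarrow> 0 \<le> g t"
  shows "ennreal (\<Sum>x\<in>I. E (measure \<nu> {x}) + g (measure \<nu> {x})) \<le> Fp p f g \<mu> \<nu>"
proof -
  interpret prob_space \<nu> by fact
  have g': "0 \<le> g (measure \<nu> {x})" for x using g by simp
  have "ennreal (\<Sum>x\<in>I. g (measure \<nu> {x})) \<le> Gen g \<nu>"
  proof (cases "\<exists>S. countable S \<and> emeasure \<nu> (space \<nu> - S) = 0")
    case True
    let ?S = "{x. measure \<nu> {x} \<noteq> 0}"
    have "ennreal (\<Sum>x\<in>I. g (measure \<nu> {x})) = (\<integral>\<^sup>+ x. ennreal (g (measure \<nu> {x})) \<partial>count_space I)"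
      using I g' by (simp add: nn_integral_count_space_finite sum_ennreal)
    also have "\<dots> = (\<integral>\<^sup>+ x. ennreal (g (measure \<nu> {x})) * indicator I x \<partial>count_space ?S)"
      using I by (subst nn_integral_count_space_indicator)
        (auto intro!: nn_integral_cong simp: nn_integral_count_space_indicator[of ?S] split: split_indicator)
    also have "\<dots> \<le> (\<integral>\<^sup>+ x. ennreal (g (measure \<nu> {x})) \<partial>count_space ?S)"
      by (intro nn_integral_mono) (auto split: split_indicator)
    finally show ?thesis using True by (simp add: Gen_def)
  next
    case False
    then show ?thesis unfolding Gen_def if_not_P[OF False] by simp
  qed
  moreover have "ennreal (\<Sum>x\<in>I. E (measure \<nu> {x}) + g (measure \<nu> {x}))
     = ennreal (\<Sum>x\<in>I. E (measure \<nu> {x})) + ennreal (\<Sum>x\<in>I. g (measure \<nu> {x}))"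
    using g' by (simp add: sum.distrib sum_nonneg E_nonneg)
  ultimately show ?thesis
    unfolding Fp_def using transport_plus_congestion_ge[OF I(1), of \<nu> \<mu>] by (simp add: add_mono)
qed

end

text \<open>Finiteness of \<open>Gen\<close> puts \<open>\<nu>\<close> on a countable set. Its
  points that are not atoms form a null set, so the atoms carry full mass, and finite pieces of an
  enumeration exhaust it.\<close>

lemma finite_atoms_approx:
  fixes \<nu> :: "'a::euclidean_space measure"
  assumes \<nu>: "prob_space \<nu>" "sets \<nu> = sets borel" and "Gen g \<nu> \<noteq> \<infinity>" and "e > 0"
  obtains I where "finite I" "I \<subseteq> {x. measure \<nu> {x} \<noteq> 0}" "(\<Sum>x\<in>I. measure \<nu> {x}) > 1 - e"
    "(\<Sum>x\<in>I. measure \<nu> {x}) \<le> 1"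
proof -
  interpret prob_space \<nu> by fact
  have sing [simp]: "countable X \<Longrightarrow> X \<in> sets \<nu>" for X
    unfolding \<nu>(2) by (rule sets.countable) simp_all
  obtain S where S: "countable S" "emeasure \<nu> (space \<nu> - S) = 0"
    using assms(3) unfolding Gen_def by (auto split: if_splits)
  have space: "space \<nu> = UNIV" using sets_eq_imp_space_eq[OF \<nu>(2)] by simp
  define B where "B = {x. measure \<nu> {x} \<noteq> 0}"
  have "B \<subseteq> S"
  proof
    fix x assume x: "x \<in> B"
    show "x \<in> S"
    proof (rule ccontr)
      assume "x \<notin> S"
      then have "emeasure \<nu> {x} \<le> emeasure \<nu> (space \<nu> - S)"
        using S(1) sets.top[of \<nu>] by (intro emeasure_mono sets.Diff) (auto simp: space)
      then show False using x S(2) by (simp add: B_def measure_def)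
    qed
  qed
  then have cB: "countable B" using S(1) countable_subset by blast
  have "S - B \<in> null_sets \<nu>"
  proof -
    have "(\<Union>x\<in>S - B. {x}) \<in> null_sets \<nu>"
      using S(1) by (intro null_sets_UN') (auto simp: B_def null_sets_def emeasure_eq_measure)
    then show ?thesis by simp
  qed
  moreover have "space \<nu> - S \<in> null_sets \<nu>" using S by (auto simp: null_sets_def)
  ultimately have "(space \<nu> - S) \<union> (S - B) \<in> null_sets \<nu>" by blast
  also have "(space \<nu> - S) \<union> (S - B) = space \<nu> - B" using \<open>B \<subseteq> S\<close> by (auto simp: space)
  finally have "measure \<nu> (space \<nu> - B) = 0" by (simp add: measure_eq_0_null_sets)
  then have prob_B: "prob B = 1" using prob_compl[of B] cB by simp
  then have "B \<noteq> {}" by auto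
  define F where "F n = from_nat_into B ` {..<n}" for n :: nat
  have F: "finite (F n)" "F n \<subseteq> B" for n
    using from_nat_into[OF \<open>B \<noteq> {}\<close>] by (auto simp: F_def)
  have "(\<Union>n. F n) = range (from_nat_into B)"
    by (simp add: F_def image_UN[symmetric] UN_lessThan_UNIV)
  then have "(\<Union>n. F n) = B"
    using range_from_nat_into[OF \<open>B \<noteq> {}\<close> cB] by simp
  moreover have "incseq F" by (auto simp: incseq_def F_def)
  moreover have "range F \<subseteq> sets \<nu>" using F(1) by (auto intro!: sing countable_finite)
  ultimately have "(\<lambda>n. prob (F n)) \<longlonglongrightarrow> 1"
    using finite_Lim_measure_incseq[of F] prob_B by simp
  then have "\<forall>\<^sub>F n in sequentially. prob (F n) > 1 - e"
    using \<open>e > 0\<close> by (intro order_tendstoD) auto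
  then obtain n where n: "prob (F n) > 1 - e" by (auto simp: eventually_sequentially)
  have "prob (F n) = (\<Sum>x\<in>F n. prob {x})"
    using F by (intro finite_measure_eq_sum_singleton) auto
  then show thesis using that[of "F n"] F n prob_le_1[of "F n"] by (auto simp: B_def[symmetric])
qed

section \<open>Realising finitely many masses\<close>

lemma ex_separated_points:
  fixes \<rho> :: real
  assumes "\<rho> > 0"
  obtains x :: "nat \<Rightarrow> 'a::euclidean_space"
  where "\<And>i j. i \<noteq> j \<Longrightarrow> ball (x i) \<rho> \<inter> ball (x j) \<rho> = {}"
proof -
  obtain b :: 'a where b: "b \<in> Basis" using nonempty_Basis by blast
  \<comment> \<open>Centres on a line at spacing \<open>2 * \<rho>\<close>; the balls are open, so
    touching does no harm.\<close>
  define x where "x i = (2 * \<rho> * real i) *\<^sub>R b" for i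
  have "dist (x i) (x j) \<ge> 2 * \<rho>" if "i \<noteq> j" for i j
  proof -
    have "x i - x j = (2 * \<rho> * (real i - real j)) *\<^sub>R b" by (simp add: x_def algebra_simps)
    then have "dist (x i) (x j) = 2 * \<rho> * \<bar>real i - real j\<bar>"
      using b assms by (simp add: dist_norm abs_mult)
    moreover have "1 \<le> \<bar>real i - real j\<bar>" using that by linarith
    ultimately show ?thesis using assms by (simp add: mult_le_cancel_left1)
  qed
  then have "ball (x i) \<rho> \<inter> ball (x j) \<rho> = {}" if "i \<noteq> j" for i j
    using that by (intro disjoint_ballI) auto
  then show thesis using that[of x] by blast
qed

context congested_transport
begin

text \<open>The equality case of Young's inequality, integrated. \<open>Phi (C m)\<close> is first
  added to both sides and cancelled at the end, which avoids subtraction of extended reals.\<close>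

lemma nn_integral_optimal_profile:
  assumes "m \<ge> 0"
  shows "(\<integral>\<^sup>+ y. ennreal (w (y - x) * kp (C m - w (y - x)) + f (kp (C m - w (y - x)))) \<partial>lborel) = ennreal (E m)"
proof -
  define v where "v y = kp (C m - w (y - x))" for y
  have [measurable]: "v \<in> borel_measurable lborel" unfolding v_def by measurable
  have [measurable]: "(\<lambda>y. f (v y)) \<in> borel_measurable lborel"
    by (rule f_comp_measurable) (auto simp: v_def)
  let ?X = "\<integral>\<^sup>+ y. ennreal (w (y - x) * v y + f (v y)) \<partial>lborel"
  have nn: "0 \<le> v y" "0 \<le> f (v y)" for y by (auto simp: v_def f_nonneg)
  have "?X + ennreal (Phi (C m)) = (\<integral>\<^sup>+ y. ennreal (w (y - x) * v y + f (v y)) + ennreal (f_star (C m - w (y - x))) \<partial>lborel)"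
    by (subst nn_integral_add) (auto simp: nn_integral_Phi)
  also have "\<dots> = (\<integral>\<^sup>+ y. ennreal (C m) * ennreal (v y) \<partial>lborel)"
  proof (rule nn_integral_cong)
    fix y
    have "w (y - x) * v y + f (v y) + f_star (C m - w (y - x)) = C m * v y"
      by (simp add: f_star_def v_def algebra_simps)
    then show "ennreal (w (y - x) * v y + f (v y)) + ennreal (f_star (C m - w (y - x))) = ennreal (C m) * ennreal (v y)"
      using nn[of y] C_nonneg[OF assms] by (simp add: ennreal_plus[symmetric] ennreal_mult[symmetric] del: ennreal_plus)
  qed
  also have "\<dots> = ennreal (C m * m)"
    using C_nonneg[OF assms] assms nn_integral_M[of "C m" x] M_C[OF assms]
    by (simp add: nn_integral_cmult v_def ennreal_mult)
  finally have "?X + ennreal (Phi (C m)) = ennreal (E m) + ennreal (Phi (C m))"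
    using E_nonneg[OF assms] Phi_nonneg by (simp add: ennreal_plus[symmetric] E_def del: ennreal_plus)
  then have "?X = ennreal (E m)"
    using ennreal_add_left_cancel[of "ennreal (Phi (C m))" ?X "ennreal (E m)"] by (simp add: add.commute)
  then show ?thesis by (simp add: v_def)
qed

text \<open>The optimal densities are superposed around widely separated centres, and a map
  \<open>T\<close> sends each support to its centre. The plan is the graph of \<open>T\<close>, so
  all costs split into single-atom costs.\<close>

lemma ex_configuration:
  fixes a :: "nat \<Rightarrow> real" and N :: nat
  assumes a: "\<And>i. i < N \<Longrightarrow> 0 \<le> a i" and sum_a: "(\<Sum>i<N. a i) = 1"
    and g: "\<And>t. 0 \<le> t \<Longrightarrow> t \<le> 1 \<Longrightarrow> 0 \<le> g t"
  shows "\<exists>\<mu>\<in>(Wp p :: 'a measure set). \<exists>\<nu>\<in>Wp p. Fp p f g \<mu> \<nu> \<le> ennreal (\<Sum>i<N. E (a i) + g (a i))"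
proof -
  \<comment> \<open>One radius that contains every support; the summand 1 makes it positive.\<close>
  define \<rho> where "\<rho> = 1 + (\<Sum>i<N. rad (C (a i)))"
  have \<rho>: "\<rho> > 0" by (simp add: \<rho>_def add_pos_nonneg sum_nonneg)
  have rad_le: "rad (C (a i)) \<le> \<rho>" if "i < N" for i
    using member_le_sum[of i "{..<N}" "\<lambda>i. rad (C (a i))"] that by (simp add: \<rho>_def)
  obtain x :: "nat \<Rightarrow> 'a" where disj: "\<And>i j. i \<noteq> j \<Longrightarrow> ball (x i) \<rho> \<inter> ball (x j) \<rho> = {}"
    using ex_separated_points[OF \<rho>] by blast
  have inj: "x i = x j \<Longrightarrow> i = j" for i j
    using disj[of i j] \<rho> by auto
  define v where "v i y = kp (C (a i) - w (y - x i))" for i y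
  have v0: "v i y \<ge> 0" for i y by (simp add: v_def)
  have [measurable]: "v i \<in> borel_measurable borel" for i unfolding v_def by measurable
  have v_ball: "y \<in> ball (x i) \<rho>" if "v i y \<noteq> 0" "i < N" for i y
  proof -
    have "w (y - x i) < C (a i)" using that(1) kp_nonpos unfolding v_def by (metis diff_le_0_iff_le not_less)
    then have "norm (y - x i) < \<rho>" using norm_less_rad rad_le[OF that(2)] by fastforce
    then show ?thesis by (simp add: dist_norm norm_minus_commute)
  qed
  define u where "u y = (\<Sum>i<N. v i y)" for y
  \<comment> \<open>Off the balls \<open>T\<close> takes the value 0, which is harmless because
    \<open>u\<close> vanishes there.\<close>
  define T where "T y = (\<Sum>i<N. indicator (ball (x i) \<rho>) y *\<^sub>R x i)" for y
  have [measurable]: "u \<in> borel_measurable borel" unfolding u_def by measurable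
  have [measurable]: "T \<in> borel_measurable borel" 
    unfolding T_def by (intro borel_measurable_sum borel_measurable_scaleR borel_measurable_indicator) auto
  have u0: "u y \<ge> 0" for y by (simp add: u_def sum_nonneg v0)
  have cases: "(\<forall>i<N. v i y = 0) \<or> (\<exists>i<N. y \<in> ball (x i) \<rho> \<and> T y = x i \<and> (\<forall>j<N. j \<noteq> i \<longrightarrow> v j y = 0))" for y
  proof (cases "\<forall>i<N. v i y = 0")
    case False
    then obtain i where i: "i < N" "v i y \<noteq> 0" by auto
    then have y: "y \<in> ball (x i) \<rho>" using v_ball by blast
    have other: "y \<notin> ball (x j) \<rho>" if "j \<noteq> i" for j using disj[OF that] y by blast
    have "T y = (\<Sum>j<N. if j = i then x i else 0)"
      unfolding T_def using y other by (intro sum.cong) (auto simp: indicator_def)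
    then have "T y = x i" using i by simp
    then show ?thesis using i y other v_ball by blast
  qed simp
  \<comment> \<open>At each point at most one of the profiles \<open>v i\<close> is nonzero, and there \<open>T\<close> is the centre \<open>x i\<close>.\<close>
  have split: "H (T y) (u y) = (\<Sum>i<N. H (x i) (v i y))" if "\<And>z. H z 0 = 0"
    for H :: "'a \<Rightarrow> real \<Rightarrow> ennreal" and y
    using cases[of y]
  proof
    assume "\<forall>i<N. v i y = 0"
    then show ?thesis using that by (simp add: u_def)
  next
    assume "\<exists>i<N. y \<in> ball (x i) \<rho> \<and> T y = x i \<and> (\<forall>j<N. j \<noteq> i \<longrightarrow> v j y = 0)"
    then obtain i where i: "i < N" "T y = x i" "\<And>j. j < N \<Longrightarrow> j \<noteq> i \<Longrightarrow> v j y = 0" by blast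
    have "u y = (\<Sum>j<N. if j = i then v i y else 0)" unfolding u_def using i by (intro sum.cong) auto
    then have "u y = v i y" using i by simp
    moreover have "(\<Sum>j<N. H (x j) (v j y)) = (\<Sum>j<N. if j = i then H (x i) (v i y) else 0)"
      using i that by (intro sum.cong) auto
    ultimately show ?thesis using i by simp
  qed
  have int_v: "(\<integral>\<^sup>+ y. ennreal (v i y) \<partial>lborel) = ennreal (a i)" if "i < N" for i
    unfolding v_def using nn_integral_M[of "C (a i)" "x i"] M_C a that by simp
  define \<mu> where "\<mu> = density lborel (\<lambda>y. ennreal (u y))"
  define \<nu> where "\<nu> = distr \<mu> borel T"
  have sets_\<mu> [measurable_cong, simp]: "sets \<mu> = sets borel" by (simp add: \<mu>_def)
  have int_\<mu>: "(\<integral>\<^sup>+ y. h y \<partial>\<mu>) = (\<integral>\<^sup>+ y. ennreal (u y) * h y \<partial>lborel)"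
    if "h \<in> borel_measurable borel" for h
    unfolding \<mu>_def using that by (intro nn_integral_density) auto
  have [measurable]: "T \<in> measurable \<mu> borel" by measurable
  have space_\<mu>: "space \<mu> = UNIV" by (simp add: \<mu>_def)
  have "(\<integral>\<^sup>+ y. ennreal (u y) \<partial>lborel) = (\<Sum>i<N. \<integral>\<^sup>+ y. ennreal (v i y) \<partial>lborel)"
    unfolding u_def using v0 by (subst nn_integral_sum[symmetric]) auto
  also have "\<dots> = ennreal (\<Sum>i<N. a i)" using int_v a by (subst sum_ennreal[symmetric]) auto
  finally have int_u: "(\<integral>\<^sup>+ y. ennreal (u y) \<partial>lborel) = 1" using sum_a by simp
  interpret \<mu>: prob_space \<mu>
    by (rule prob_spaceI) (use int_u in \<open>simp add: \<mu>_def emeasure_density\<close>)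
  interpret \<nu>: prob_space \<nu> unfolding \<nu>_def by (rule \<mu>.prob_space_distr) measurable
  have sets_\<nu>: "sets \<nu> = sets borel" by (simp add: \<nu>_def)
  have emeasure_\<nu>: "emeasure \<nu> X = (\<integral>\<^sup>+ y. indicator X (T y) \<partial>\<mu>)" if "X \<in> sets borel" for X
  proof -
    have "emeasure \<nu> X = (\<integral>\<^sup>+ z. indicator X z \<partial>\<nu>)" using that sets_\<nu> by simp
    also have "\<dots> = (\<integral>\<^sup>+ y. indicator X (T y) \<partial>\<mu>)"
      unfolding \<nu>_def using that by (intro nn_integral_distr) auto
    finally show ?thesis .
  qed
  define B where "B = (\<Sum>i<N. norm (x i)) + \<rho>"
  have B: "norm (x i) + \<rho> \<le> B" if "i < N" for i
    using member_le_sum[of i "{..<N}" "\<lambda>i. norm (x i)"] that by (simp add: B_def)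
  have bound: "norm y \<le> B \<and> norm (T y) \<le> B" if "u y \<noteq> 0" for y
  proof -
    have "\<not> (\<forall>i<N. v i y = 0)" using that unfolding u_def by (auto intro: sum.neutral)
    then obtain i where i: "i < N" "y \<in> ball (x i) \<rho>" "T y = x i" using cases[of y] by blast
    have "norm y \<le> norm (x i) + norm (y - x i)" by (metis add.commute diff_add_cancel norm_triangle_ineq)
    then show ?thesis using i B[OF i(1)] \<rho> by (simp add: dist_norm norm_minus_commute)
  qed
  have moment: "(\<integral>\<^sup>+ y. ennreal (norm (S y) powr p) \<partial>\<mu>) < \<infinity>"
    if [measurable]: "S \<in> borel_measurable borel" and S: "\<And>y. u y \<noteq> 0 \<Longrightarrow> norm (S y) \<le> B" for S :: "'a \<Rightarrow> 'a"
  proof -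
    have "(\<integral>\<^sup>+ y. ennreal (norm (S y) powr p) \<partial>\<mu>) = (\<integral>\<^sup>+ y. ennreal (u y) * ennreal (norm (S y) powr p) \<partial>lborel)"
      by (rule int_\<mu>) measurable
    also have "\<dots> \<le> (\<integral>\<^sup>+ y. ennreal (u y) * ennreal (B powr p) \<partial>lborel)"
    proof (rule nn_integral_mono)
      fix y
      show "ennreal (u y) * ennreal (norm (S y) powr p) \<le> ennreal (u y) * ennreal (B powr p)"
      proof (cases "u y = 0")
        case False
        then show ?thesis using S[OF False] p_ge_1 by (intro mult_left_mono ennreal_leI powr_mono2) auto
      qed simp
    qed
    also have "\<dots> = ennreal (B powr p)" using int_u by (simp add: nn_integral_multc)
    finally show ?thesis by (simp add: le_less_trans)
  qed
  have \<mu>_Wp: "\<mu> \<in> Wp p"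
    using moment[of "\<lambda>y. y"] bound \<mu>.prob_space_axioms by (simp add: Wp_def)
  have \<nu>_Wp: "\<nu> \<in> Wp p"
    using moment[of T] bound \<nu>.prob_space_axioms by (simp add: Wp_def \<nu>_def nn_integral_distr)
  have atom: "measure \<nu> {x i} = a i" if i: "i < N" for i
  proof -
    have "emeasure \<nu> {x i} = (\<integral>\<^sup>+ y. indicator {x i} (T y) \<partial>\<mu>)"
      by (rule emeasure_\<nu>) simp
    also have "\<dots> = (\<integral>\<^sup>+ y. ennreal (u y) * indicator {x i} (T y) \<partial>lborel)"
      by (rule int_\<mu>) measurable
    also have "\<dots> = (\<integral>\<^sup>+ y. ennreal (v i y) \<partial>lborel)"
    proof (rule nn_integral_cong)
      fix y
      have "ennreal (u y) * indicator {x i} (T y) = (\<Sum>j<N. ennreal (v j y) * indicator {x i} (x j))"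
        using split[of "\<lambda>z t. ennreal t * indicator {x i} z" y] by simp
      also have "\<dots> = (\<Sum>j<N. if j = i then ennreal (v i y) else 0)"
        by (intro sum.cong) (auto simp: indicator_def dest: inj)
      also have "\<dots> = ennreal (v i y)" using i by simp
      finally show "ennreal (u y) * indicator {x i} (T y) = ennreal (v i y)" .
    qed
    finally show ?thesis using int_v[OF i] a[OF i] by (simp add: measure_def)
  qed
  have off: "emeasure \<nu> (space \<nu> - x ` {..<N}) = 0"
  proof -
    have "(\<Union>i<N. {x i}) \<in> sets borel" by (intro sets.finite_UN) auto
    then have [measurable]: "x ` {..<N} \<in> sets borel" by (simp add: UNION_singleton_eq_range)
    have "emeasure \<nu> (space \<nu> - x ` {..<N}) = (\<integral>\<^sup>+ y. indicator (- x ` {..<N}) (T y) \<partial>\<mu>)"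
      by (subst emeasure_\<nu>) (auto simp: \<nu>_def Compl_eq_Diff_UNIV)
    also have "\<dots> = (\<integral>\<^sup>+ y. ennreal (u y) * indicator (- x ` {..<N}) (T y) \<partial>lborel)"
      by (rule int_\<mu>) measurable
    also have "\<dots> = (\<integral>\<^sup>+ y. 0 \<partial>(lborel :: 'a measure))"
    proof (rule nn_integral_cong)
      fix y
      have "ennreal (u y) * indicator (- x ` {..<N}) (T y) = (\<Sum>j<N. ennreal (v j y) * indicator (- x ` {..<N}) (x j))"
        using split[of "\<lambda>z t. ennreal t * indicator (- x ` {..<N}) z" y] by simp
      then show "ennreal (u y) * indicator (- x ` {..<N}) (T y) = 0" by simp
    qed
    finally show ?thesis by simp
  qed
  have a_le: "a i \<le> 1" if "i < N" for i
    using member_le_sum[of i "{..<N}" a] that a sum_a by simp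
  have g_a: "0 \<le> g (a i)" if "i < N" for i using g a_le a that by simp
  \<comment> \<open>An inequality suffices, and it spares a case distinction: centres with
    \<open>a i = 0\<close> are not atoms, yet they appear in the sum.\<close>
  have "Gen g \<nu> \<le> ennreal (\<Sum>i<N. g (a i))"
  proof -
    let ?S = "{z. measure \<nu> {z} \<noteq> 0}"
    have sub: "?S \<subseteq> x ` {..<N}"
    proof
      fix z assume z: "z \<in> ?S"
      show "z \<in> x ` {..<N}"
      proof (rule ccontr)
        assume "z \<notin> x ` {..<N}"
        moreover have "x ` {..<N} \<in> sets \<nu>" unfolding sets_\<nu> by (rule sets.countable) auto
        ultimately have "emeasure \<nu> {z} \<le> emeasure \<nu> (space \<nu> - x ` {..<N})"
          by (intro emeasure_mono) (auto simp: \<nu>_def)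
        then show False using z off by (simp add: measure_def)
      qed
    qed
    have "countable (x ` {..<N})" by simp
    then have "Gen g \<nu> = (\<integral>\<^sup>+ z. ennreal (g (measure \<nu> {z})) \<partial>count_space ?S)"
      unfolding Gen_def using off by (subst if_P) blast+
    also have "\<dots> = (\<Sum>z\<in>?S. ennreal (g (measure \<nu> {z})))"
      using sub finite_subset by (intro nn_integral_count_space_finite) blast
    also have "\<dots> \<le> (\<Sum>z\<in>x ` {..<N}. ennreal (g (measure \<nu> {z})))"
      using sub by (intro sum_mono2) auto
    also have "\<dots> = (\<Sum>i<N. ennreal (g (a i)))"
      using inj atom by (subst sum.reindex) (auto simp: inj_on_def)
    also have "\<dots> = ennreal (\<Sum>i<N. g (a i))" using g_a by (subst sum_ennreal) auto
    finally show ?thesis .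
  qed
  moreover have "Tp p \<mu> \<nu> + Fen f \<mu> \<le> ennreal (\<Sum>i<N. E (a i))"
  proof -
    define \<gamma> where "\<gamma> = distr \<mu> (borel \<Otimes>\<^sub>M borel) (\<lambda>y. (y, T y))"
    have [measurable]: "(\<lambda>y. f (u y)) \<in> borel_measurable borel"
      by (rule f_comp_measurable) (use u0 in auto)
    have [measurable]: "(\<lambda>y. f (v i y)) \<in> borel_measurable borel" for i
      by (rule f_comp_measurable) (use v0 in auto)
    have "distr \<mu> borel (\<lambda>y. y) = \<mu>" by (rule distr_id2) simp
    then have "\<gamma> \<in> plans \<mu> \<nu>"
      unfolding plans_def \<gamma>_def
      by (auto simp: \<nu>_def distr_distr comp_def intro!: \<mu>.prob_space_distr)
    then have "Tp p \<mu> \<nu> \<le> (\<integral>\<^sup>+ z. ennreal (norm (fst z - snd z) powr p) \<partial>\<gamma>)"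
      unfolding Tp_def by (rule INF_lower)
    also have "\<dots> = (\<integral>\<^sup>+ y. ennreal (w (y - T y)) \<partial>\<mu>)"
      unfolding \<gamma>_def by (subst nn_integral_distr) (auto simp: w_eq)
    also have "\<dots> = (\<integral>\<^sup>+ y. ennreal (u y) * ennreal (w (y - T y)) \<partial>lborel)"
      by (rule int_\<mu>) measurable
    finally have "Tp p \<mu> \<nu> + Fen f \<mu> \<le> (\<integral>\<^sup>+ y. ennreal (u y) * ennreal (w (y - T y)) \<partial>lborel) + (\<integral>\<^sup>+ y. ennreal (f (u y)) \<partial>lborel)"
      using Fen_density[OF _ u0 \<mu>_def] by (simp add: add_right_mono)
    also have "\<dots> = (\<integral>\<^sup>+ y. ennreal (w (y - T y) * u y + f (u y)) \<partial>lborel)"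
      using u0 f_nonneg
      by (subst nn_integral_add[symmetric]) (auto simp: ennreal_mult[symmetric] mult.commute)
    also have "\<dots> = (\<integral>\<^sup>+ y. (\<Sum>i<N. ennreal (w (y - x i) * v i y + f (v i y))) \<partial>lborel)"
    proof (rule nn_integral_cong)
      show "ennreal (w (y - T y) * u y + f (u y)) = (\<Sum>i<N. ennreal (w (y - x i) * v i y + f (v i y)))" for y
        using split[of "\<lambda>z t. ennreal (w (y - z) * t + f t)" y] f_0 by simp
    qed
    also have "\<dots> = (\<Sum>i<N. \<integral>\<^sup>+ y. ennreal (w (y - x i) * v i y + f (v i y)) \<partial>lborel)"
      by (rule nn_integral_sum) measurable
    also have "\<dots> = ennreal (\<Sum>i<N. E (a i))"
      unfolding v_def using a by (subst sum_ennreal[symmetric]) (auto simp: nn_integral_optimal_profile E_nonneg)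
    finally show ?thesis .
  qed
  ultimately have "Fp p f g \<mu> \<nu> \<le> ennreal (\<Sum>i<N. E (a i)) + ennreal (\<Sum>i<N. g (a i))"
    unfolding Fp_def by (intro add_mono)
  also have "\<dots> = ennreal (\<Sum>i<N. E (a i) + g (a i))"
    using a g_a E_nonneg unfolding sum.distrib by (intro ennreal_plus[symmetric] sum_nonneg) auto
  finally show ?thesis using \<mu>_Wp \<nu>_Wp by blast
qed

end

section \<open>Minimisation over finite mass distributions\<close>

lemma ex_min_on_simplex:
  fixes h :: "real \<Rightarrow> real"
  assumes "N > 0" and h: "continuous_on {0..1} h"
  obtains a :: "nat \<Rightarrow> real" where "\<And>i. i < N \<Longrightarrow> 0 \<le> a i" "(\<Sum>i<N. a i) = 1"
    "\<And>b. \<lbrakk>\<And>i. i < N \<Longrightarrow> 0 \<le> b i; (\<Sum>i<N. b i) = 1\<rbrakk> \<Longrightarrow> (\<Sum>i<N. h (a i)) \<le> (\<Sum>i<N. h (b i))"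
proof -
  \<comment> \<open>Fixing the coordinates from \<open>N\<close> on to 0 makes the cube compact in
    the product topology on all sequences.\<close>
  define B where "B = (PiE UNIV (\<lambda>i::nat. if i < N then {0..1::real} else {0}))"
  define K where "K = B \<inter> {a. (\<Sum>i<N. a i) = 1}"
  have "compactin (product_topology (\<lambda>i::nat. euclidean :: real topology) UNIV) B"
    unfolding B_def by (subst compactin_PiE) auto
  then have "compact B" by (simp add: euclidean_product_topology)
  moreover have "closed {a :: nat \<Rightarrow> real. (\<Sum>i<N. a i) = 1}"
    by (intro closed_Collect_eq continuous_intros continuous_on_product_coordinates)
  ultimately have "compact K" unfolding K_def by (rule compact_Int_closed)
  moreover have "(\<lambda>i. if i = 0 then 1 else 0) \<in> K"
    using \<open>N > 0\<close> by (auto simp: K_def B_def)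
  moreover have "continuous_on K (\<lambda>a. \<Sum>i<N. h (a i))"
  proof (intro continuous_on_sum)
    fix i assume "i \<in> {..<N}"
    then have "(\<lambda>a. a i) ` K \<subseteq> {0..1}" by (force simp: K_def B_def PiE_iff split: if_splits)
    then have "continuous_on K (h \<circ> (\<lambda>a. a i))"
      using h by (intro continuous_on_compose continuous_on_subset[OF h])
        (auto intro: continuous_on_subset[OF continuous_on_product_coordinates])
    then show "continuous_on K (\<lambda>a. h (a i))" by (simp add: comp_def)
  qed
  ultimately obtain a where a: "a \<in> K" "\<And>b. b \<in> K \<Longrightarrow> (\<Sum>i<N. h (a i)) \<le> (\<Sum>i<N. h (b i))"
    using continuous_attains_inf[of K "\<lambda>a. \<Sum>i<N. h (a i)"] by blast
  show thesis
  proof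
    show "0 \<le> a i" if "i < N" for i
      using a(1) that by (force simp: K_def B_def PiE_iff split: if_splits)
    show "(\<Sum>i<N. a i) = 1" using a(1) by (simp add: K_def)
    fix b :: "nat \<Rightarrow> real" assume b: "\<And>i. i < N \<Longrightarrow> 0 \<le> b i" "(\<Sum>i<N. b i) = 1"
    have "b i \<le> 1" if "i < N" for i
      using member_le_sum[of i "{..<N}" b] b that by simp
    then have "(\<lambda>i. if i < N then b i else 0) \<in> K"
      using b by (auto simp: K_def B_def)
    from a(2)[OF this] show "(\<Sum>i<N. h (a i)) \<le> (\<Sum>i<N. h (b i))" by simp
  qed
qed

text \<open>At most \<open>2 / \<delta>\<close> masses exceed \<open>\<delta> / 2\<close>. If there
  are more than \<open>N\<close> of them, two are at most \<open>\<delta> / 2\<close>; merging these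
  stays within \<open>\<delta>\<close>, does not raise the cost and lowers the number.\<close>

lemma merge_small_masses:
  fixes h :: "real \<Rightarrow> real" and a :: "'i \<Rightarrow> real"
  assumes "finite I" and "\<And>i. i \<in> I \<Longrightarrow> 0 \<le> a i" and "(\<Sum>i\<in>I. a i) = 1"
    and "\<delta> > 0" and N: "real N \<ge> 2 / \<delta> + 1"
    and subadd: "\<And>s t. 0 \<le> s \<Longrightarrow> 0 \<le> t \<Longrightarrow> s + t \<le> \<delta> \<Longrightarrow> h (s + t) \<le> h s + h t"
  shows "\<exists>(J :: 'i set) b. finite J \<and> card J \<le> N \<and> (\<forall>i\<in>J. 0 \<le> b i) \<and> (\<Sum>i\<in>J. b i) = 1 \<and>
    (\<Sum>i\<in>J. h (b i)) \<le> (\<Sum>i\<in>I. h (a i))"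
  using assms(1-3)
proof (induction "card I" arbitrary: I a rule: less_induct)
  case less
  show ?case
  proof (cases "card I \<le> N")
    case True
    then show ?thesis using less.prems by (intro exI[of _ I] exI[of _ a]) auto
  next
    case False
    define L where "L = {i \<in> I. a i > \<delta> / 2}"
    have "card L * (\<delta> / 2) \<le> (\<Sum>i\<in>L. a i)"
      using sum_bounded_below[of L "\<delta> / 2" a] by (auto simp: L_def)
    also have "\<dots> \<le> (\<Sum>i\<in>I. a i)"
      using less.prems by (intro sum_mono2) (auto simp: L_def)
    finally have "real (card L) \<le> 2 / \<delta>" using less.prems \<open>\<delta> > 0\<close> by (simp add: field_simps)
    \<comment> \<open>The spare 1 in the bound on \<open>N\<close> is what guarantees two small
      masses rather than one.\<close>
    then have "card L + 1 \<le> N" using N by linarith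
    moreover have "card (I - L) = card I - card L"
      using less.prems by (intro card_Diff_subset) (auto simp: L_def)
    ultimately have "2 \<le> card (I - L)" using False by linarith
    then obtain i j where ij: "i \<in> I - L" "j \<in> I - L" "i \<noteq> j"
      by (metis card_2_iff' card_le_Suc0_iff_eq card.infinite less_eq_Suc_le not_less numeral_2_eq_2 zero_less_Suc not_less_eq_eq)
    define b where "b = a(i := a i + a j)"
    have I: "I = insert i (insert j (I - {i, j}))" "I - {j} = insert i (I - {i, j})" using ij by auto
    have fin: "finite (I - {i, j})" using less.prems by simp
    have *: "(\<Sum>l\<in>I. q (a l)) = q (a i) + q (a j) + (\<Sum>l\<in>I - {i, j}. q (a l))"
      "(\<Sum>l\<in>I - {j}. q (b l)) = q (a i + a j) + (\<Sum>l\<in>I - {i, j}. q (a l))" for q :: "real \<Rightarrow> real"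
    proof -
      show "(\<Sum>l\<in>I. q (a l)) = q (a i) + q (a j) + (\<Sum>l\<in>I - {i, j}. q (a l))"
        by (subst I(1)) (use fin ij in simp)
      have "(\<Sum>l\<in>I - {i, j}. q (b l)) = (\<Sum>l\<in>I - {i, j}. q (a l))"
        by (intro sum.cong) (auto simp: b_def)
      then show "(\<Sum>l\<in>I - {j}. q (b l)) = q (a i + a j) + (\<Sum>l\<in>I - {i, j}. q (a l))"
        by (subst I(2)) (use fin ij in \<open>simp add: b_def\<close>)
    qed
    have "h (a i + a j) \<le> h (a i) + h (a j)"
      using ij less.prems by (intro subadd) (auto simp: L_def)
    then have le: "(\<Sum>l\<in>I - {j}. h (b l)) \<le> (\<Sum>l\<in>I. h (a l))" using *[of h] by simp
    have card: "card (I - {j}) < card I" using less.prems ij by (intro psubset_card_mono) auto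
    have sum: "(\<Sum>l\<in>I - {j}. b l) = 1" using *[of "\<lambda>t. t"] less.prems by simp
    have nonneg: "0 \<le> b l" if "l \<in> I - {j}" for l using that less.prems ij by (auto simp: b_def)
    have "\<exists>(J :: 'i set) b'. finite J \<and> card J \<le> N \<and> (\<forall>i\<in>J. 0 \<le> b' i) \<and> (\<Sum>i\<in>J. b' i) = 1 \<and>
        (\<Sum>i\<in>J. h (b' i)) \<le> (\<Sum>i\<in>I - {j}. h (b i))"
      by (rule less.hyps) (use card nonneg sum less.prems in auto)
    then show ?thesis using le by (elim exE conjE) (intro exI conjI, assumption+, rule order_trans)
  qed
qed

text \<open>Padding with zero masses is free as \<open>h 0 = 0\<close>, so families of at most
  \<open>N\<close> masses become points of one simplex.\<close>

lemma sum_nth_enumeration: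
  fixes h :: "real \<Rightarrow> real"
  assumes "finite J" "card J \<le> N" "h 0 = 0" "\<And>i. i \<in> J \<Longrightarrow> 0 \<le> b i"
  obtains c :: "nat \<Rightarrow> real" where "\<And>i. 0 \<le> c i" "(\<Sum>i<N. c i) = (\<Sum>i\<in>J. b i)"
    "(\<Sum>i<N. h (c i)) = (\<Sum>i\<in>J. h (b i))"
proof -
  obtain e where e: "bij_betw e {..<card J} J"
    using ex_bij_betw_nat_finite[OF assms(1)] by (auto simp: atLeast0LessThan)
  define c where "c i = (if i < card J then b (e i) else 0)" for i
  have "(\<Sum>i<N. q (c i)) = (\<Sum>i\<in>J. q (b i))" if "q 0 = 0" for q :: "real \<Rightarrow> real"
  proof -
    have "(\<Sum>i<N. q (c i)) = (\<Sum>i<card J. q (c i))"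
      using assms(2) that by (intro sum.mono_neutral_right) (auto simp: c_def)
    also have "\<dots> = (\<Sum>i<card J. q (b (e i)))" by (simp add: c_def)
    also have "\<dots> = (\<Sum>i\<in>J. q (b i))" by (rule sum.reindex_bij_betw[OF e])
    finally show ?thesis .
  qed
  from this[of "\<lambda>t. t"] this[of h] show thesis
    using that[of c] assms(3,4) bij_betwE[OF e] by (auto simp: c_def)
qed

section \<open>Existence of a minimiser from subadditivity near zero\<close>

context congested_transport
begin

theorem ex_minimizer:
  fixes g :: "real \<Rightarrow> real"
  assumes g: "\<And>t. 0 \<le> t \<Longrightarrow> t \<le> 1 \<Longrightarrow> 0 \<le> g t" and g0: "g 0 = 0" and g_cont: "continuous_on {0..1} g"
    and "\<delta> > 0"
    and subadd: "\<And>s t. 0 \<le> s \<Longrightarrow> 0 \<le> t \<Longrightarrow> s + t \<le> \<delta> \<Longrightarrow> E (s + t) + g (s + t) \<le> E s + g s + (E t + g t)"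
  shows "\<exists>\<mu>\<in>(Wp p :: 'a measure set). \<exists>\<nu>\<in>(Wp p :: 'a measure set). \<forall>\<mu>'\<in>(Wp p :: 'a measure set).
    \<forall>\<nu>'\<in>(Wp p :: 'a measure set). Fp p f g \<mu> \<nu> \<le> Fp p f g \<mu>' \<nu>'"
proof -
  define h where "h t = E t + g t" for t
  have h0: "h 0 = 0" by (simp add: h_def E_0 g0)
  have h_cont: "continuous_on {0..1} h"
    unfolding h_def by (intro continuous_intros continuous_on_E g_cont)
  obtain N where N: "real N \<ge> 2 / \<delta> + 1" using real_arch_simple by blast
  moreover have "0 < 2 / \<delta>" using \<open>\<delta> > 0\<close> by simp
  ultimately have "N > 0" by (cases N) auto
  obtain a where a: "\<And>i. i < N \<Longrightarrow> 0 \<le> a i" "(\<Sum>i<N. a i) = 1"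
    and a_min: "\<And>b. \<lbrakk>\<And>i. i < N \<Longrightarrow> 0 \<le> b i; (\<Sum>i<N. b i) = 1\<rbrakk> \<Longrightarrow> (\<Sum>i<N. h (a i)) \<le> (\<Sum>i<N. h (b i))"
    using ex_min_on_simplex[OF \<open>N > 0\<close> h_cont] by blast
  define V where "V = (\<Sum>i<N. h (a i))"
  have V_le: "V \<le> (\<Sum>i\<in>I. h (b i))"
    if I: "finite I" "\<And>i. i \<in> I \<Longrightarrow> 0 \<le> b i" "(\<Sum>i\<in>I. b i) = 1" for I :: "'a option set" and b
  proof -
    have h_subadd: "h (s + t) \<le> h s + h t" if "0 \<le> s" "0 \<le> t" "s + t \<le> \<delta>" for s t
      using subadd[OF that] by (simp add: h_def)
    obtain J b' where J: "finite J" "card J \<le> N" "\<And>i::'a option. i \<in> J \<Longrightarrow> 0 \<le> b' i" "(\<Sum>i\<in>J. b' i) = 1"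
      "(\<Sum>i\<in>J. h (b' i)) \<le> (\<Sum>i\<in>I. h (b i))"
      using merge_small_masses[OF I \<open>\<delta> > 0\<close> N h_subadd] by blast
    obtain c :: "nat \<Rightarrow> real" where "\<And>i. 0 \<le> c i" "(\<Sum>i<N. c i) = (\<Sum>i\<in>J. b' i)"
      "(\<Sum>i<N. h (c i)) = (\<Sum>i\<in>J. h (b' i))"
      using sum_nth_enumeration[of J N h b'] J h0 by blast
    then show ?thesis using a_min[of c] J unfolding V_def by simp
  qed
  have lower: "ennreal V \<le> Fp p f g \<mu>' \<nu>'" if \<nu>': "\<nu>' \<in> (Wp p :: 'a measure set)" for \<mu>' \<nu>'
  proof (cases "Fp p f g \<mu>' \<nu>'")
    case (real r)
    then have "Gen g \<nu>' \<noteq> \<infinity>" by (auto simp: Fp_def)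
    have ps: "prob_space \<nu>'" "sets \<nu>' = sets borel" using \<nu>' by (auto simp: Wp_def)
    have "V \<le> r + \<eta>" if "\<eta> > 0" for \<eta>
    proof -
      \<comment> \<open>Fixes how little mass a finite set of atoms may miss: a single extra atom of
        mass below \<open>e\<close> costs at most \<open>\<eta>\<close>.\<close>
      have "((\<lambda>s. h s) \<longlongrightarrow> 0) (at 0 within {0..1})"
        using h_cont h0 unfolding continuous_on_def by (metis atLeastAtMost_iff order_refl zero_le_one)
      then have "eventually (\<lambda>s. h s < \<eta>) (at 0 within {0..1})"
        using that by (rule order_tendstoD)
      then obtain e where e: "e > 0" "\<And>s. s \<in> {0..1} \<Longrightarrow> s \<noteq> 0 \<Longrightarrow> s < e \<Longrightarrow> h s < \<eta>"
        unfolding eventually_at by (auto simp: dist_real_def)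
      obtain I where I: "finite I" "I \<subseteq> {x. measure \<nu>' {x} \<noteq> 0}"
        "(\<Sum>x\<in>I. measure \<nu>' {x}) > 1 - e" "(\<Sum>x\<in>I. measure \<nu>' {x}) \<le> 1"
        using finite_atoms_approx[OF ps \<open>Gen g \<nu>' \<noteq> \<infinity>\<close> e(1)] by blast
      \<comment> \<open>The mass missed by \<open>I\<close> is collected in one extra atom, indexed by \<open>None\<close>.\<close>
      define s where "s = 1 - (\<Sum>x\<in>I. measure \<nu>' {x})"
      define b where "b i = (case i of None \<Rightarrow> s | Some x \<Rightarrow> measure \<nu>' {x})" for i
      have s: "0 \<le> s" "s \<le> 1" "s < e"
        using I by (auto simp: s_def intro: sum_nonneg)
      have sum_b: "(\<Sum>i\<in>insert None (Some ` I). q (b i)) = q s + (\<Sum>x\<in>I. q (measure \<nu>' {x}))" for q :: "real \<Rightarrow> real"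
        using I(1) by (simp add: sum.reindex b_def)
      have "(\<Sum>i\<in>insert None (Some ` I). b i) = 1" using sum_b[of "\<lambda>t. t"] by (simp add: s_def)
      then have "V \<le> (\<Sum>i\<in>insert None (Some ` I). h (b i))"
        using I(1) s by (intro V_le) (auto simp: b_def)
      also have "\<dots> = h s + (\<Sum>x\<in>I. h (measure \<nu>' {x}))" by (rule sum_b)
      also have "h s \<le> \<eta>" using e(2)[of s] s h0 that by (cases "s = 0") auto
      finally have "V \<le> \<eta> + (\<Sum>x\<in>I. h (measure \<nu>' {x}))" by simp
      moreover have "ennreal (\<Sum>x\<in>I. h (measure \<nu>' {x})) \<le> ennreal r"
        using Fp_ge_finite_atoms[where \<mu> = \<mu>' and g = g, OF I(1,2) ps(1) g] real by (simp add: h_def)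
      then have "(\<Sum>x\<in>I. h (measure \<nu>' {x})) \<le> r" using real by (simp add: ennreal_le_iff)
      ultimately show ?thesis by simp
    qed
    then have "V \<le> r" by (rule field_le_epsilon)
    then show ?thesis using real by (simp add: ennreal_leI)
  qed simp
  obtain \<mu> \<nu> :: "'a measure" where "\<mu> \<in> Wp p" "\<nu> \<in> Wp p" "Fp p f g \<mu> \<nu> \<le> ennreal V"
    using ex_configuration[where a = a and g = g, OF a g] unfolding V_def h_def by blast
  then show ?thesis using lower by (meson order_trans)
qed

end

section \<open>From the limsup condition to subadditivity near zero\<close>

theorem theorem4p6:
  fixes f f' f'' k k' g g' g'' :: "real \<Rightarrow> real" and p :: real
  assumes p1: "p \<ge> 1"
    and f_nonneg: "\<forall>t\<ge>0. 0 \<le> f t"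
    and f_conv: "strictly_convex_on {0..} f"
    and f_deriv: "\<forall>t\<ge>0. (f has_real_derivative f' t) (at t within {0..})"
    and f'_cont: "continuous_on {0..} f'"
    and f0: "f 0 = 0" and f'0: "f' 0 = 0"
    and f_superlin: "filterlim (\<lambda>t. f t / t) at_top at_top"
    and f'_deriv: "\<forall>t>0. (f' has_real_derivative f'' t) (at t)"
    and f''_cont: "continuous_on {0<..} f''"
    and k_inv: "\<forall>s\<ge>0. 0 \<le> k s \<and> f' (k s) = s"
    and k_deriv: "\<forall>s>0. (k has_real_derivative k' s) (at s)"
    and g_nonneg: "\<forall>t\<in>{0..1}. 0 \<le> g t"
    and g_subadd: "\<forall>a b. 0 \<le> a \<longrightarrow> 0 \<le> b \<longrightarrow> a + b \<le> 1 \<longrightarrow> g (a + b) \<le> g a + g b"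
    and g_lsc: "lsc_on {0..1} g"
    and g0: "g 0 = 0"
    and g_slope: "filterlim (\<lambda>t. g t / t) at_top (at_right 0)"
    and g_cont: "continuous_on {0..1} g"
    and g_deriv: "\<forall>t\<in>{0<..1}. (g has_real_derivative g' t) (at t within {0<..1})"
    and g'_deriv: "\<forall>t\<in>{0<..1}. (g' has_real_derivative g'' t) (at t within {0<..1})"
    and g''_cont: "continuous_on {0<..1} g''"
    and cond: "Limsup (at_right 0) (\<lambda>R.
        ereal (g'' (LBINT r=0..R. k (R powr p - r powr p) * (real DIM('a) * measure lborel (ball (0::'a::euclidean_space) 1)) * r ^ (DIM('a) - 1)))
        * enn2ereal (\<integral>\<^sup>+ r. indicator {0..R} r * ennreal (k' (R powr p - r powr p) * (real DIM('a) * measure lborel (ball (0::'a) 1)) * r ^ (DIM('a) - 1)) \<partial>lborel))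
      < - 1"
  shows "\<exists>\<mu>\<in>(Wp p :: 'a measure set). \<exists>\<nu>\<in>(Wp p :: 'a measure set). \<forall>\<mu>'\<in>(Wp p :: 'a measure set). \<forall>\<nu>'\<in>(Wp p :: 'a measure set). Fp p f g \<mu> \<nu> \<le> Fp p f g \<mu>' \<nu>'"
proof -
  interpret congested_transport f f' k k' p "\<lambda>y::'a. norm y powr p"
    by unfold_locales (use p1 f_nonneg f_conv f_deriv f0 f'0 k_inv k_deriv in auto)
  have interior: "at m within {0<..1} = at m" if "0 < m" "m < 1" for m :: real
    by (rule at_within_open_subset[of _ "{0<..<1}"]) (use that in auto)
  have g1: "(g has_real_derivative g' m) (at m)" if "0 < m" "m < 1" for m
    using g_deriv[rule_format, of m] interior[OF that] that by simp
  have g2: "(g' has_real_derivative g'' m) (at m)" if "0 < m" "m < 1" for m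
    using g'_deriv[rule_format, of m] interior[OF that] that by simp
  have g3: "isCont g'' m" if "0 < m" "m < 1" for m
    using g''_cont[unfolded continuous_on_eq_continuous_within, rule_format, of m] interior[OF that] that
    by simp
  \<comment> \<open>A real number strictly between the limsup and -1 gives the uniform factor
    \<open>\<beta> > 1\<close> used in the concavity argument.\<close>
  obtain \<beta>' :: real where \<beta>': "ereal \<beta>' < - 1"
    and lim: "Limsup (at_right 0) (\<lambda>R.
        ereal (g'' (LBINT r=0..R. k (R powr p - r powr p) * (real DIM('a) * measure lborel (ball (0::'a) 1)) * r ^ (DIM('a) - 1)))
        * enn2ereal (\<integral>\<^sup>+ r. indicator {0..R} r * ennreal (k' (R powr p - r powr p) * (real DIM('a) * measure lborel (ball (0::'a) 1)) * r ^ (DIM('a) - 1)) \<partial>lborel))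
      < ereal \<beta>'"
    using ereal_dense2[OF cond] by blast
  define \<beta> where "\<beta> = - \<beta>'"
  have \<beta>: "\<beta> > 1" using \<beta>' by (simp add: \<beta>_def one_ereal_def)
  obtain R0 where R0: "R0 > 0"
    "\<And>R. 0 < R \<Longrightarrow> R < R0 \<Longrightarrow> ereal (g'' (M (R powr p))) * enn2ereal (A (R powr p)) < ereal \<beta>'"
    using Limsup_lessD[OF lim] M_radial A_radial unfolding eventually_at_right_field by force
  have key: "ereal (g'' (M s)) * enn2ereal (A s) < ereal \<beta>'" if "0 < s" "s < R0 powr p" for s
  proof -
    have "s powr (1 / p) < (R0 powr p) powr (1 / p)"
      using that p1 by (intro powr_less_mono2) auto
    then have "s powr (1 / p) < R0" using R0(1) p1 by (simp add: powr_powr)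
    moreover have "(s powr (1 / p)) powr p = s" using that p1 by (simp add: powr_powr)
    ultimately show ?thesis using R0(2)[of "s powr (1 / p)"] that by simp
  qed
  \<comment> \<open>Since \<open>A s\<close> is nonnegative, a negative product forces
    \<open>g''\<close> to be negative.\<close>
  have neg: "g'' (M s) < 0" if "0 < s" "s < R0 powr p" for s
  proof (rule ccontr)
    assume "\<not> ?thesis"
    then have "0 \<le> ereal (g'' (M s)) * enn2ereal (A s)" by simp
    also note key[OF that]
    finally show False using \<beta> by (simp add: \<beta>_def)
  qed
  \<comment> \<open>Where \<open>A s\<close> is infinite nothing is to be shown; elsewhere the
    product is one of real numbers and can be solved for \<open>A s\<close>.\<close>
  have A_ge: "ennreal (\<beta> / (- g'' (M s))) \<le> A s" if s: "0 < s" "s < R0 powr p" for s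
  proof (cases "A s")
    case (real r)
    then have "g'' (M s) * r < - \<beta>" using key[OF s] by (simp add: \<beta>_def enn2ereal_ennreal)
    then have "\<beta> / (- g'' (M s)) \<le> r" using neg[OF s] by (simp add: field_simps)
    then show ?thesis using real by (simp add: ennreal_leI)
  qed simp
  \<comment> \<open>Masses below 1 stay away from the right endpoint, where \<open>g\<close> has
    only one-sided derivatives.\<close>
  have "eventually (\<lambda>s. M s < 1) (at 0)"
    using isCont_M[of 0] M_nonpos[of 0] by (intro order_tendstoD(2)[where y = "M 0"]) (auto simp: isCont_def)
  then obtain d where d: "d > 0" "\<And>s. s \<noteq> 0 \<Longrightarrow> \<bar>s\<bar> < d \<Longrightarrow> M s < 1"
    unfolding eventually_at by (auto simp: dist_real_def)
  define \<epsilon> where "\<epsilon> = min (d / 2) (R0 powr p)"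
  have \<epsilon>: "0 < \<epsilon>" "\<epsilon> < d" "\<epsilon> \<le> R0 powr p" using d(1) R0(1) by (auto simp: \<epsilon>_def)
  then have "M \<epsilon> < 1" using d(2)[of \<epsilon>] by simp
  \<comment> \<open>Halving \<open>M \<epsilon>\<close> turns the strict bound on
    \<open>s + t\<close> into the non-strict one with which masses are merged.\<close>
  have "E (s + t) + g (s + t) \<le> E s + g s + (E t + g t)" if "0 \<le> s" "0 \<le> t" "s + t \<le> M \<epsilon> / 2" for s t
    using E_plus_g_subadditive_near_0[OF \<beta> \<epsilon>(1) \<open>M \<epsilon> < 1\<close> g0 g_cont g1 g2 g3 neg A_ge, of s t] that M_pos[OF \<epsilon>(1)] \<epsilon>(3)
    by auto
  then show ?thesis
    using g_nonneg g0 g_cont M_pos[OF \<epsilon>(1)] by (intro ex_minimizer[where \<delta> = "M \<epsilon> / 2"]) auto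
qed

end
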